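(* Let $X_\sigma=\operatorname{Spec}(k[\Lambda])$ be a three-dimensional (not necessarily isolated) affine toric Gorenstein singularity over a field $k$ of characteristic $0$, with canonical degree $R^*\in M$. Under the identifications $T^1(-R^* )\cong V/(k\cdot\underline 1)$ and $T^2(-2R^* )\cong \ker\eta/\operatorname{im}\delta$ described in the context, the cup product $T^1(-R^* )\times T^1(-R^* )\to T^2(-2R^* )$ equals the bilinear map $$V/(k\cdot \underline{1})\times V/(k\cdot \underline{1})\to \ker\eta/\operatorname{im}\delta,\qquad (\underline t,\underline s)\mapsto (s_1t_1d_1,\dots,s_Nt_Nd_N).$$
   Context: **Toric setting.** $k$ is a field of characteristic $0$; $M,N$ are mutually dual free abelian groups of rank $3$ (the letter $N$ also denotes the number of generators below), $N_k=N\otimes_{\mathbb Z}k$, $M_k=M\otimes_{\mathbb Z}k$, with pairing $\langle\cdot,\cdot\rangle$. Let $P$ be a lattice polygon in the affine hyperplane $\mathbb R^2\times\{1\}\subset \mathbb R^3=N_{\mathbb R}$, $\sigma=\operatorname{Cone}(P)=\langle a_1,\dots,a_N\rangle$, where $a_1,\dots,a_N\in N$ are the vertices of $P$ arranged in a cycle, $a_{N+1}:=a_1$. Put $\Lambda=\sigma^\vee\cap M$, $R^*=(0,0,1)\in M$ (so $\langle a_j,R^*\rangle=1$ for all $j$), $d_j:=a_{j+1}-a_j$, $\ell(d_j)$ the lattice length of $d_j$, and $$V=\{\underline t=(t_1,\dots,t_N)\in k^N\mid \textstyle\sum_{j=1}^N t_jd_j=0\},\qquad \underline 1=(1,\dots,1).$$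 For $R\in M$ let $\Lambda(R)=\Lambda+R$ and $K_{a_j}^R=\{r\in\Lambda\mid \langle a_j,r\rangle<\langle a_j,R\rangle\}$; one has $\Lambda\setminus\Lambda(R)=\bigcup_jK^R_{a_j}$. **Harrison cochains.** For $Q\subset\Lambda$ let $S_n(Q)=\{(\lambda_1,\dots,\lambda_n)\in Q^n\mid \sum_v\lambda_v\in Q\}$. Let $s_{i,n-i}=\sum(\operatorname{sgn}\pi)\pi$ over permutations $\pi\in S_n$ with $\pi(1)<\dots<\pi(i)$ and $\pi(i+1)<\dots<\pi(n)$, and $s_n=\sum_{i=1}^{n-1}s_{i,n-i}$, acting on $n$-tuples by $\pi(\lambda_1,\dots,\lambda_n)=(\lambda_{\pi^{-1}(1)},\dots,\lambda_{\pi^{-1}(n)})$. For $L=\Lambda$, $L=\Lambda\setminus\Lambda(R)$, or $L$ an intersection of sets $K^R_{a_j}$, let $C^n_{(1)}(L;k)$ be the space of functions $\varphi:S_n(L)\to k$ with $\varphi\circ s_n=0$ ($\varphi$ extended linearly), and let $C^n_{(1)}(\Lambda,\Lambda\setminus\Lambda(R);k)\subset C^n_{(1)}(\Lambda;k)$ be the subspace of those vanishing on $S_n(\Lambda\setminus\Lambda(R))$. The differential is $$(d\varphi)(\lambda_1,\dots,\lambda_n)=\varphi(\lambda_2,\dots,\lambda_n)+\sum_{i=1}^{n-1}(-1)^i\varphi(\lambda_1,\dots,\lambda_i+\lambda_{i+1},\dots,\lambda_n)+(-1)^n\varphi(\lambda_1,\dots,\lambda_{n-1}),$$ and $H^n_{(1)}(\cdot)$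 denotes the cohomology. $H^1_{(1)}(L;k)$ is the space of functions $f:L\to k$ with $f(a+b)=f(a)+f(b)$ whenever $a,b,a+b\in L$. Set $T^{n-1}(-R):=H^n_{(1)}(\Lambda,\Lambda\setminus\Lambda(R);k)$ (this is the degree $-R$ part of the André–Quillen cohomology $T^{n-1}(k[\Lambda])$). **Cup product.** For $R,S\in M$ the cup product $T^1(-R)\times T^1(-S)\to T^2(-R-S)$ is induced by $$[f,g](\lambda_1,\lambda_2,\lambda_3)=f(-S+\lambda_1+\lambda_2,\lambda_3)g(\lambda_1,\lambda_2)-f(\lambda_1,-S+\lambda_2+\lambda_3)g(\lambda_2,\lambda_3)+g(-R+\lambda_1+\lambda_2,\lambda_3)f(\lambda_1,\lambda_2)-g(\lambda_1,-R+\lambda_2+\lambda_3)f(\lambda_2,\lambda_3)$$ for $f\in C^2_{(1)}(\Lambda,\Lambda\setminus\Lambda(R);k)$, $g\in C^2_{(1)}(\Lambda,\Lambda\setminus\Lambda(S);k)$; a product is read as $0$ when one of its arguments is not in $\Lambda$ (then the other factor vanishes). **Identification of $T^1(-R^* )$.** For $\underline t\in V$ choose $b_1,\dots,b_N\in (R^* )^\perp\subset N_k$ with $b_{j+1}-b_j=t_jd_j$ for all $j$ (cyclically). The functions $\langle b_j,\cdot\rangle$ on $K^{R^*}_{a_j}$ glue to $\xi\in H^1_{(1)}(\Lambda\setminus\Lambda(R^* );k)$. Let $\xi^0:\Lambda\to k$ be the extension of $\xi$ by $0$. The class of $d\xi^0$ in $T^1(-R^* )$ depends only on $\underline t$ modulo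 $k\cdot\underline 1$, and $\underline t\mapsto\overline{d\xi^0}$ is the identification $V/(k\cdot\underline1)\cong T^1(-R^* )$. **Identification of $T^2(-2R^* )$.** Let $\delta_j=0$ if $\ell(d_j)<2$ and $\delta_j=1$ if $\ell(d_j)\ge2$. One has $\operatorname{span}_k(K^{2R^*}_{a_j})=M_k$ and $\operatorname{span}_k(K^{2R^*}_{a_j}\cap K^{2R^*}_{a_{j+1}})=(\delta_jd_j)^\perp$. Consider $$N_k^N\xrightarrow{\ \delta\ }\bigoplus_{j=1}^N N_k/(k\,\delta_jd_j)\xrightarrow{\ \eta\ }\Big(\operatorname{span}_k\big(\textstyle\bigcap_jK^{2R^*}_{a_j}\big)\Big)^*,$$ $$\delta(b_1,\dots,b_N)=(b_1-b_2,b_2-b_3,\dots,b_N-b_1),\qquad \eta(q_1,\dots,q_N)=\sum_{j=1}^Nq_j.$$ Given a cocycle $c\in C^3_{(1)}(\Lambda,\Lambda\setminus\Lambda(2R^* );k)$ there are $C\in C^2_{(1)}(\Lambda;k)$ with $dC=c$ and $G_j\in C^1_{(1)}(K^{2R^*}_{a_j};k)$ with $dG_j=C|_{K^{2R^*}_{a_j}}$. Then $(G_j-G_{j+1})_j$ is an element of $\bigoplus_jH^1_{(1)}(K^{2R^*}_{a_j}\cap K^{2R^*}_{a_{j+1}};k)$ defining a class in the cohomology at the middle term of $\bigoplus_jH^1_{(1)}(K^{2R^*}_{a_j};k)\to\bigoplus_jH^1_{(1)}(K^{2R^*}_{a_j}\cap K^{2R^*}_{a_{j+1}};k)\to H^1_{(1)}(\bigcap_jK^{2R^*}_{a_j};k)$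 (maps defined by the same formulas as $\delta$, $\eta$). This gives an isomorphism from $T^2(-2R^* )$ to that cohomology, and restricting linear functions to the sets in question induces an isomorphism from $\ker\eta/\operatorname{im}\delta$ to the same cohomology; together these identify $T^2(-2R^* )$ with $\ker\eta/\operatorname{im}\delta$.
   Formalization: The identification of T^2(-2R^* ) uses the class of (G_{j+1}-G_j)_j instead of (G_j-G_{j+1})_j; with the convention as stated the cup product would be -(s_j t_j d_j), which differs from (s_j t_j d_j), for example for the lattice hexagon. *)

theory Defs
  imports
    "HOL-Analysis.Analysis"
    "HOL-Combinatorics.Permutations"
    "HOL-Library.Function_Algebras"
begin

text \<open>
  The lattices \<open>M\<close> and \<open>N\<close> are both \<open>int^3\<close>, their scalar extensions \<open>M\<^sub>k\<close> and \<open>N\<^sub>k\<close> are \<open>'k^3\<close>,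
  and \<open>pairing\<close> is the standard pairing. Vertices are numbered \<open>0, \<dots>, n - 1\<close>, read cyclically. A family
  indexed by the vertices is a function on \<open>nat\<close> that is zero from \<open>n\<close> on, and a function on a
  set of tuples is extended by zero, so that equal families and functions are equal terms.
\<close>

section \<open>The toric setting\<close>

type_synonym lattice = "int^3"

definition kvec :: "lattice \<Rightarrow> 'k::ring_1^3" where
  "kvec v = (\<chi> i. of_int (v $ i))"

definition pairing :: "'r::comm_ring_1^3 \<Rightarrow> 'r^3 \<Rightarrow> 'r" where
  "pairing b m = (\<Sum>i\<in>UNIV. b $ i * m $ i)"

definition Rstar :: lattice where
  "Rstar = axis 3 1"

definition nxt :: "nat \<Rightarrow> nat \<Rightarrow> nat" where
  "nxt n j = Suc j mod n"

definition polygon :: "nat \<Rightarrow> (nat \<Rightarrow> lattice) \<Rightarrow> (real^3) set" where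
  "polygon n a = convex hull ((\<lambda>j. kvec (a j)) ` {..<n})"

text \<open>That consecutive \<open>a j\<close> span edges says that the vertices are listed in cyclic order.\<close>

definition lattice_polygon :: "nat \<Rightarrow> (nat \<Rightarrow> lattice) \<Rightarrow> bool" where
  "lattice_polygon n a \<longleftrightarrow>
     n \<ge> 3 \<and> inj_on a {..<n} \<and> (\<forall>j<n. a j $ 3 = 1) \<and>
     aff_dim (polygon n a) = 2 \<and>
     {x. x extreme_point_of polygon n a} = (\<lambda>j. kvec (a j)) ` {..<n} \<and>
     (\<forall>j<n. closed_segment (kvec (a j)) (kvec (a (nxt n j))) edge_of polygon n a)"

definition cone_over :: "nat \<Rightarrow> (nat \<Rightarrow> lattice) \<Rightarrow> (real^3) set" where
  "cone_over n a = convex_cone hull (polygon n a)"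

definition Lam :: "nat \<Rightarrow> (nat \<Rightarrow> lattice) \<Rightarrow> lattice set" where
  "Lam n a = {r. \<forall>x\<in>cone_over n a. 0 \<le> pairing x (kvec r)}"

definition edge_vec :: "nat \<Rightarrow> (nat \<Rightarrow> lattice) \<Rightarrow> nat \<Rightarrow> lattice" where
  "edge_vec n a j = a (nxt n j) - a j"

definition lattice_length :: "lattice \<Rightarrow> int" where
  "lattice_length v = Gcd (range (($) v))"

definition shifted :: "lattice set \<Rightarrow> lattice \<Rightarrow> lattice set" where
  "shifted L R = (\<lambda>r. r + R) ` L"

definition Kset :: "nat \<Rightarrow> (nat \<Rightarrow> lattice) \<Rightarrow> lattice \<Rightarrow> nat \<Rightarrow> lattice set" where
  "Kset n a R j = {r \<in> Lam n a. pairing (a j) r < pairing (a j) R}"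

section \<open>Harrison cochains\<close>

definition tuples :: "nat \<Rightarrow> lattice set \<Rightarrow> lattice list set" where
  "tuples n Q = {xs. length xs = n \<and> set xs \<subseteq> Q \<and> sum_list xs \<in> Q}"

definition shuffle_perms :: "nat \<Rightarrow> nat \<Rightarrow> (nat \<Rightarrow> nat) set" where
  "shuffle_perms i n = {p. p permutes {..<n} \<and> strict_mono_on {..<i} p \<and> strict_mono_on {i..<n} p}"

definition cochains :: "nat \<Rightarrow> lattice set \<Rightarrow> (lattice list \<Rightarrow> 'k::field_char_0) set" where
  "cochains n L = {\<phi>. (\<forall>xs. xs \<notin> tuples n L \<longrightarrow> \<phi> xs = 0) \<and>
     (\<forall>xs\<in>tuples n L.
        (\<Sum>i=1..<n. \<Sum>p\<in>shuffle_perms i n. of_int (sign p) * \<phi> (permute_list (inv p) xs)) = 0)}"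

text \<open>The differential on \<open>L\<close>; the degree is that of the argument list.\<close>

definition hdiff :: "lattice set \<Rightarrow> (lattice list \<Rightarrow> 'k::field_char_0) \<Rightarrow> lattice list \<Rightarrow> 'k" where
  "hdiff L \<phi> = (\<lambda>xs. if xs \<in> tuples (length xs) L then
       \<phi> (tl xs)
       + (\<Sum>i=1..<length xs.
            (-1) ^ i * \<phi> (take (i - 1) xs @ [xs ! (i - 1) + xs ! i] @ drop (i + 1) xs))
       + (-1) ^ length xs * \<phi> (butlast xs)
     else 0)"

definition restr :: "lattice set \<Rightarrow> (lattice list \<Rightarrow> 'k::field_char_0) \<Rightarrow> lattice list \<Rightarrow> 'k" where
  "restr L \<phi> = (\<lambda>xs. if xs \<in> tuples (length xs) L then \<phi> xs else 0)"

definition H1 :: "lattice set \<Rightarrow> (lattice list \<Rightarrow> 'k::field_char_0) set" where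
  "H1 L = {\<phi> \<in> cochains 1 L. hdiff L \<phi> = 0}"

definition rel_cochains ::
    "nat \<Rightarrow> lattice set \<Rightarrow> lattice \<Rightarrow> (lattice list \<Rightarrow> 'k::field_char_0) set" where
  "rel_cochains n L R = {\<phi> \<in> cochains n L. \<forall>xs\<in>tuples n (L - shifted L R). \<phi> xs = 0}"

definition rel_cocycles ::
    "nat \<Rightarrow> lattice set \<Rightarrow> lattice \<Rightarrow> (lattice list \<Rightarrow> 'k::field_char_0) set" where
  "rel_cocycles n L R = {\<phi> \<in> rel_cochains n L R. hdiff L \<phi> = 0}"

definition cohomologous ::
    "nat \<Rightarrow> lattice set \<Rightarrow> lattice \<Rightarrow> (lattice list \<Rightarrow> 'k::field_char_0) rel" where
  "cohomologous n L R = {(\<phi>, \<psi>). \<phi> \<in> rel_cocycles n L R \<and> \<psi> \<in> rel_cocycles n L R \<and>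
     \<phi> - \<psi> \<in> hdiff L ` rel_cochains (n - 1) L R}"

definition T_mod ::
    "nat \<Rightarrow> lattice set \<Rightarrow> lattice \<Rightarrow> (lattice list \<Rightarrow> 'k::field_char_0) set set" where
  "T_mod i L R = rel_cocycles (i + 1) L R // cohomologous (i + 1) L R"

section \<open>The cup product\<close>

text \<open>
  A map between quotients that is induced by a formula on representatives is defined below as the
  union of the classes obtained from all representatives and all auxiliary choices. This union
  is a single class only if the choices do not matter.

  A value of \<open>f\<close> or \<open>g\<close> at a tuple with an entry outside \<open>L\<close> is zero by the extension convention.
\<close>

definition bracket ::
    "lattice set \<Rightarrow> lattice \<Rightarrow> lattice \<Rightarrow> (lattice list \<Rightarrow> 'k::field_char_0) \<Rightarrow>
     (lattice list \<Rightarrow> 'k) \<Rightarrow> lattice list \<Rightarrow> 'k" where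
  "bracket L R S f g = (\<lambda>xs. if xs \<in> tuples 3 L then
       (let x = xs ! 0; y = xs ! 1; z = xs ! 2 in
          f [- S + x + y, z] * g [x, y] - f [x, - S + y + z] * g [y, z]
        + g [- R + x + y, z] * f [x, y] - g [x, - R + y + z] * f [y, z])
     else 0)"

definition cup ::
    "lattice set \<Rightarrow> lattice \<Rightarrow> lattice \<Rightarrow> (lattice list \<Rightarrow> 'k::field_char_0) set \<Rightarrow>
     (lattice list \<Rightarrow> 'k) set \<Rightarrow> (lattice list \<Rightarrow> 'k) set" where
  "cup L R S A B = (\<Union>f\<in>A. \<Union>g\<in>B. cohomologous 3 L (R + S) `` {bracket L R S f g})"

section \<open>The space \<open>V/(k\<cdot>1)\<close> and its identification with \<open>T\<^sup>1(-R\<^sup>*)\<close>\<close>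

definition Vsp :: "nat \<Rightarrow> (nat \<Rightarrow> lattice) \<Rightarrow> (nat \<Rightarrow> 'k::field_char_0) set" where
  "Vsp n a = {t. (\<forall>j\<ge>n. t j = 0) \<and> (\<Sum>j<n. t j *s kvec (edge_vec n a j)) = 0}"

definition mod_ones :: "nat \<Rightarrow> (nat \<Rightarrow> lattice) \<Rightarrow> (nat \<Rightarrow> 'k::field_char_0) rel" where
  "mod_ones n a = {(t, t'). t \<in> Vsp n a \<and> t' \<in> Vsp n a \<and> (\<exists>c. \<forall>j<n. t j - t' j = c)}"

definition T1_choice :: "nat \<Rightarrow> (nat \<Rightarrow> lattice) \<Rightarrow> (nat \<Rightarrow> 'k::field_char_0) \<Rightarrow> (nat \<Rightarrow> 'k^3) \<Rightarrow> bool" where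
  "T1_choice n a t b \<longleftrightarrow>
     (\<forall>j<n. pairing (b j) (kvec Rstar) = 0 \<and> b (nxt n j) - b j = t j *s kvec (edge_vec n a j))"

text \<open>As functions are extended by zero, \<open>\<xi>\<close> itself serves as \<open>\<xi>\<^sup>0\<close>.\<close>

definition T1_glued ::
    "nat \<Rightarrow> (nat \<Rightarrow> lattice) \<Rightarrow> (nat \<Rightarrow> 'k::field_char_0^3) \<Rightarrow> (lattice list \<Rightarrow> 'k) \<Rightarrow> bool" where
  "T1_glued n a b \<xi> \<longleftrightarrow> \<xi> \<in> H1 (Lam n a - shifted (Lam n a) Rstar) \<and>
     (\<forall>j<n. \<forall>r\<in>Kset n a Rstar j. \<xi> [r] = pairing (b j) (kvec r))"

definition T1_ident ::
    "nat \<Rightarrow> (nat \<Rightarrow> lattice) \<Rightarrow> (nat \<Rightarrow> 'k::field_char_0) set \<Rightarrow> (lattice list \<Rightarrow> 'k) set" where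
  "T1_ident n a \<tau> =
     \<Union>{cohomologous 2 (Lam n a) Rstar `` {hdiff (Lam n a) \<xi>} | t b \<xi>.
         t \<in> \<tau> \<and> T1_choice n a t b \<and> T1_glued n a b \<xi>}"

section \<open>The space \<open>ker \<eta> / im \<delta>\<close> and its identification with \<open>T\<^sup>2(-2R\<^sup>*)\<close>\<close>

definition K2 :: "nat \<Rightarrow> (nat \<Rightarrow> lattice) \<Rightarrow> nat \<Rightarrow> lattice set" where
  "K2 n a j = Kset n a (Rstar + Rstar) j"

definition edge_delta :: "nat \<Rightarrow> (nat \<Rightarrow> lattice) \<Rightarrow> nat \<Rightarrow> 'k::field_char_0" where
  "edge_delta n a j = (if lattice_length (edge_vec n a j) < 2 then 0 else 1)"

text \<open>
  Elements of the direct sum of the spaces \<open>N\<^sub>k/(k \<delta>\<^sub>j d\<^sub>j)\<close> are represented by families in \<open>N\<^sub>k\<close>;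
  \<open>ker_eta\<close> and \<open>im_delta\<close> are the preimages of \<open>ker \<eta>\<close> and \<open>im \<delta>\<close> in \<open>N\<^sub>k\<^sup>n\<close>, so that their
  quotient is \<open>ker \<eta> / im \<delta>\<close>.
\<close>

definition ker_eta :: "nat \<Rightarrow> (nat \<Rightarrow> lattice) \<Rightarrow> (nat \<Rightarrow> 'k::field_char_0^3) set" where
  "ker_eta n a = {q. (\<forall>j\<ge>n. q j = 0) \<and>
     (\<forall>m\<in>vec.span (kvec ` (\<Inter>j<n. K2 n a j)). pairing (\<Sum>j<n. q j) m = 0)}"

definition im_delta :: "nat \<Rightarrow> (nat \<Rightarrow> lattice) \<Rightarrow> (nat \<Rightarrow> 'k::field_char_0^3) set" where
  "im_delta n a = {q. (\<forall>j\<ge>n. q j = 0) \<and>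
     (\<exists>b c. \<forall>j<n. q j = b j - b (nxt n j) + c j *s (edge_delta n a j *s kvec (edge_vec n a j)))}"

definition eta_rel :: "nat \<Rightarrow> (nat \<Rightarrow> lattice) \<Rightarrow> (nat \<Rightarrow> 'k::field_char_0^3) rel" where
  "eta_rel n a = {(q, q'). q \<in> ker_eta n a \<and> q' \<in> ker_eta n a \<and> q - q' \<in> im_delta n a}"

text \<open>The middle cohomology of the complex of the spaces \<open>H1\<close>.\<close>

definition pair_restr ::
    "nat \<Rightarrow> (nat \<Rightarrow> lattice) \<Rightarrow> (nat \<Rightarrow> lattice list \<Rightarrow> 'k::field_char_0) \<Rightarrow> nat \<Rightarrow> lattice list \<Rightarrow> 'k" where
  "pair_restr n a h = (\<lambda>j. if j < n then restr (K2 n a j \<inter> K2 n a (nxt n j)) (h j) else 0)"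

definition mid_ker :: "nat \<Rightarrow> (nat \<Rightarrow> lattice) \<Rightarrow> (nat \<Rightarrow> lattice list \<Rightarrow> 'k::field_char_0) set" where
  "mid_ker n a = {h. (\<forall>j\<ge>n. h j = 0) \<and> (\<forall>j<n. h j \<in> H1 (K2 n a j \<inter> K2 n a (nxt n j))) \<and>
     restr (\<Inter>j<n. K2 n a j) (\<Sum>j<n. h j) = 0}"

definition mid_im :: "nat \<Rightarrow> (nat \<Rightarrow> lattice) \<Rightarrow> (nat \<Rightarrow> lattice list \<Rightarrow> 'k::field_char_0) set" where
  "mid_im n a = {pair_restr n a (\<lambda>j. g j - g (nxt n j)) | g. \<forall>j<n. g j \<in> H1 (K2 n a j)}"

definition mid_rel :: "nat \<Rightarrow> (nat \<Rightarrow> lattice) \<Rightarrow> (nat \<Rightarrow> lattice list \<Rightarrow> 'k::field_char_0) rel" where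
  "mid_rel n a = {(h, h'). h \<in> mid_ker n a \<and> h' \<in> mid_ker n a \<and> h - h' \<in> mid_im n a}"

definition T2_choice ::
    "nat \<Rightarrow> (nat \<Rightarrow> lattice) \<Rightarrow> (lattice list \<Rightarrow> 'k::field_char_0) \<Rightarrow>
     (nat \<Rightarrow> lattice list \<Rightarrow> 'k) \<Rightarrow> bool" where
  "T2_choice n a c G \<longleftrightarrow> (\<exists>C\<in>cochains 2 (Lam n a). hdiff (Lam n a) C = c \<and>
     (\<forall>j<n. G j \<in> cochains 1 (K2 n a j) \<and> hdiff (K2 n a j) (G j) = restr (K2 n a j) C))"

text \<open>
  Sign convention: the connecting map uses the Cech coboundary \<open>G\<^sub>j\<^sub>+\<^sub>1 - G\<^sub>j\<close>. With the
  opposite convention \<open>G\<^sub>j - G\<^sub>j\<^sub>+\<^sub>1\<close> the identification, and hence the cup product in these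
  coordinates, changes sign. In fact, let \<open>b\<close>, \<open>\<xi>\<close> and \<open>b'\<close>, \<open>\<xi>'\<close> be the choices for \<open>t\<close> and \<open>s\<close>,
  \<open>f = d\<xi>\<close>, \<open>g = d\<xi>'\<close>, \<open>R = R\<^sup>*\<close>. The bracket \<open>[f, g]\<close> is the coboundary of
  \<open>C(x, y) = \<xi>(x) \<xi>'(y) + \<xi>'(x) \<xi>(y) - \<xi>(x + y - R) g(x, y) - \<xi>'(x + y - R) f(x, y)\<close>, the
  restriction of \<open>C\<close> to \<open>K2 n a j\<close> is the coboundary of \<open>G\<^sub>j = b\<^sub>j b'\<^sub>j - b\<^sub>j \<xi>' - b'\<^sub>j \<xi>\<close>, and
  \<open>G\<^sub>j\<^sub>+\<^sub>1 - G\<^sub>j\<close> is \<open>s\<^sub>j t\<^sub>j d\<^sub>j\<close> on \<open>K2 n a j \<inter> K2 n a (j + 1)\<close>.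
\<close>

definition T2_mid ::
    "nat \<Rightarrow> (nat \<Rightarrow> lattice) \<Rightarrow> (lattice list \<Rightarrow> 'k::field_char_0) set \<Rightarrow>
     (nat \<Rightarrow> lattice list \<Rightarrow> 'k) set" where
  "T2_mid n a A =
     \<Union>{mid_rel n a `` {pair_restr n a (\<lambda>j. G (nxt n j) - G j)} | c G. c \<in> A \<and> T2_choice n a c G}"

definition lin_fun :: "'k::field_char_0^3 \<Rightarrow> lattice list \<Rightarrow> 'k" where
  "lin_fun q = (\<lambda>xs. if length xs = 1 then pairing q (kvec (hd xs)) else 0)"

text \<open>
  Restricting linear functions embeds \<open>ker \<eta> / im \<delta>\<close> into the middle cohomology; the inverse of
  this map sends a class to its preimage.
\<close>

definition T2_ident ::
    "nat \<Rightarrow> (nat \<Rightarrow> lattice) \<Rightarrow> (lattice list \<Rightarrow> 'k::field_char_0) set \<Rightarrow> (nat \<Rightarrow> 'k^3) set" where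
  "T2_ident n a A = {q \<in> ker_eta n a. pair_restr n a (\<lambda>j. lin_fun (q j)) \<in> T2_mid n a A}"

definition edge_product ::
    "nat \<Rightarrow> (nat \<Rightarrow> lattice) \<Rightarrow> (nat \<Rightarrow> 'k::field_char_0) set \<Rightarrow> (nat \<Rightarrow> 'k) set \<Rightarrow> (nat \<Rightarrow> 'k^3) set" where
  "edge_product n a \<tau> \<sigma> =
     (\<Union>t\<in>\<tau>. \<Union>s\<in>\<sigma>. eta_rel n a `` {\<lambda>j. (s j * t j) *s kvec (edge_vec n a j)})"

end

theory Submission
  imports Defs
begin

text \<open>
  A class in \<open>T\<^sup>1(-R\<^sup>*)\<close> that comes from \<open>t\<close> consists of the coboundaries \<open>d\<phi>\<close> of all
  functions \<open>\<phi>\<close> on \<open>\<Lambda>\<close> that agree with the linear function \<open>b\<^sub>j\<close> on the face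
  \<open>\<langle>a\<^sub>j, r\<rangle> = 0\<close> of the dual cone, for every \<open>j\<close>. Here \<open>b\<close> may be any choice that belongs
  to any representative of the class of \<open>t\<close>: two choices differ by \<open>v + c a\<^sub>j\<close>, where \<open>v\<close> has
  coboundary zero and \<open>a\<^sub>j\<close> vanishes on its face (\<open>T1_ident_eq\<close>). The linear functions on different
  faces fit together because two faces meet in a ray of the dual cone, on which \<open>d\<^sub>j\<close> vanishes,
  or only in the origin (\<open>T1_choice_agree\<close>).

  For two such functions \<open>\<phi>\<close> and \<open>\<psi>\<close> with linear parts \<open>b\<close> and \<open>b'\<close> the bracket of the
  coboundaries is itself the coboundary of the symmetric cochain
  \<open>C(x, y) = \<phi>(x) \<psi>(y) + \<psi>(x) \<phi>(y) - \<phi>(x + y - R\<^sup>*) d\<psi>(x, y) - \<psi>(x + y - R\<^sup>*) d\<phi>(x, y)\<close>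
  (\<open>bracket_eq_coboundary\<close>), and on the set \<open>\<langle>a\<^sub>j, r\<rangle> \<le> 1\<close> the cochain \<open>C\<close> is the coboundary of
  \<open>G\<^sub>j = b\<^sub>j b'\<^sub>j - b\<^sub>j \<psi> - b'\<^sub>j \<phi>\<close> (\<open>bracket_primitive_on_K2\<close>). On the overlap of two
  consecutive sets \<open>\<langle>d\<^sub>j, r\<rangle>\<close> is \<open>0\<close>, \<open>1\<close> or \<open>-1\<close>, and if it is not zero then \<open>r\<close> lies on one of
  the two faces, where \<open>\<phi>\<close> and \<open>\<psi>\<close> are linear; this gives
  \<open>G\<^sub>j\<^sub>+\<^sub>1 - G\<^sub>j = s\<^sub>j t\<^sub>j d\<^sub>j\<close> (\<open>local_primitive_edge\<close>).

  It remains to see that no choice matters. If \<open>\<phi>\<close> and \<open>\<psi>\<close> change, then the differences of the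
  functions \<open>G\<^sub>j\<close> glue to one function whose coboundary accounts for the change of \<open>C\<close>
  (\<open>bracket_cohomologous\<close>). If another primitive \<open>C'\<close> of a cohomologous cocycle is used, the difference
  is a symmetric 2-cocycle on \<open>\<Lambda>\<close> up to a cochain that vanishes on the sets in question, and a symmetric
  cocycle on \<open>\<Lambda>\<close> is a coboundary, since it describes a commutative extension of a monoid whose
  group completion is free (\<open>symmetric_cocycle_on_cone_splits\<close>). Finally the comparison of
  \<open>ker \<eta> / im \<delta>\<close> with the middle cohomology is injective (\<open>lin_fun_mid_im_iff\<close>): every additive function
  on \<open>\<langle>a\<^sub>j, r\<rangle> \<le> 1\<close> is linear (\<open>additive_on_K2_linear\<close>), and a linear function that vanishes on the overlap
  of two consecutive sets is a multiple of \<open>\<delta>\<^sub>j d\<^sub>j\<close> (\<open>annihilator_of_edge\<close>).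
\<close>

section \<open>Quotients by a subgroup\<close>

text \<open>
  The relations that define the cohomology groups, \<open>V/(k\<cdot>1)\<close>, \<open>ker \<eta> / im \<delta>\<close> and the middle
  cohomology all have this form.
\<close>

lemma equiv_diff_subgroup:
  fixes B :: "'a::ab_group_add set"
  assumes zero: "0 \<in> B" and diff: "\<And>x y. x \<in> B \<Longrightarrow> y \<in> B \<Longrightarrow> x - y \<in> B"
  shows "equiv Z {(x, y). x \<in> Z \<and> y \<in> Z \<and> x - y \<in> B}"
proof (rule equivI)
  show "sym {(x, y). x \<in> Z \<and> y \<in> Z \<and> x - y \<in> B}"
    using diff[OF zero] by (fastforce simp: sym_def)
  have "x - z \<in> B" if "x - y \<in> B" "y - z \<in> B" for x y z
    using diff[OF that(1) diff[OF zero that(2)]] by simp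
  then show "trans {(x, y). x \<in> Z \<and> y \<in> Z \<and> x - y \<in> B}"
    unfolding trans_def by blast
qed (use zero in \<open>auto simp: refl_on_def\<close>)

section \<open>Harrison cochains of low degree\<close>

lemma mem_tuples: "xs \<in> tuples (length xs) L \<longleftrightarrow> set xs \<subseteq> L \<and> sum_list xs \<in> L"
  by (simp add: tuples_def)

lemma tuples_1: "xs \<in> tuples 1 L \<longleftrightarrow> (\<exists>x\<in>L. xs = [x])"
  by (auto simp: tuples_def length_Suc_conv)

lemma tuples_2: "xs \<in> tuples 2 L \<longleftrightarrow> (\<exists>x y. xs = [x, y] \<and> x \<in> L \<and> y \<in> L \<and> x + y \<in> L)"
  by (auto simp: tuples_def length_Suc_conv numeral_2_eq_2)

lemma tuples_3:
  "xs \<in> tuples 3 L \<longleftrightarrow> (\<exists>x y z. xs = [x, y, z] \<and> x \<in> L \<and> y \<in> L \<and> z \<in> L \<and> x + y + z \<in> L)"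
  by (auto simp: tuples_def length_Suc_conv numeral_3_eq_3 add.assoc)

lemma tuples_4:
  "xs \<in> tuples 4 L \<longleftrightarrow> (\<exists>w x y z. xs = [w, x, y, z] \<and> w \<in> L \<and> x \<in> L \<and> y \<in> L \<and> z \<in> L
     \<and> w + x + y + z \<in> L)"
  by (auto simp: tuples_def length_Suc_conv numeral_eq_Suc add.assoc)

lemma hdiff_2:
  "hdiff L \<phi> [x, y] = (if x \<in> L \<and> y \<in> L \<and> x + y \<in> L then \<phi> [x] + \<phi> [y] - \<phi> [x + y] else 0)"
  by (simp add: hdiff_def mem_tuples del: length_Cons)

lemma hdiff_3:
  "hdiff L \<phi> [x, y, z] = (if x \<in> L \<and> y \<in> L \<and> z \<in> L \<and> x + y + z \<in> L
     then \<phi> [y, z] - \<phi> [x + y, z] + \<phi> [x, y + z] - \<phi> [x, y] else 0)"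
proof -
  have "{1..<3::nat} = {1, 2}" by auto
  then show ?thesis
    by (simp add: hdiff_def mem_tuples add.assoc numeral_3_eq_3[symmetric] del: length_Cons)
qed

lemma hdiff_4:
  "hdiff L \<phi> [w, x, y, z] = (if w \<in> L \<and> x \<in> L \<and> y \<in> L \<and> z \<in> L \<and> w + x + y + z \<in> L
     then \<phi> [x, y, z] - \<phi> [w + x, y, z] + \<phi> [w, x + y, z] - \<phi> [w, x, y + z] + \<phi> [w, x, y] else 0)"
proof -
  have *: "{Suc 0..<4::nat} = {1, 2, 3}" by auto
  have 4: "length [w, x, y, z] = 4" by simp
  show ?thesis
    unfolding hdiff_def mem_tuples 4 by (simp add: * add.assoc)
qed

text \<open>
  Every argument of \<open>\<phi>\<close> in the differential is one shorter than the argument of the differential;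
  the bound on the degree excludes the empty list, which has itself as its tail.
\<close>

lemma hdiff_outside:
  assumes "\<And>xs. xs \<notin> tuples n L \<Longrightarrow> \<phi> xs = 0" and "n \<ge> 1" and "xs \<notin> tuples (Suc n) L"
  shows "hdiff L \<phi> xs = 0"
proof (cases "xs \<in> tuples (length xs) L")
  case True
  then have len: "length xs \<noteq> Suc n" using assms(3) by auto
  have zero: "\<phi> ys = 0" if "length ys \<noteq> n" for ys
    using assms(1) that by (auto simp: tuples_def)
  have 1: "\<phi> (tl xs) = 0" "\<phi> (butlast xs) = 0"
    by (rule zero; use len assms(2) in simp)+
  have 2: "\<phi> (take (i - 1) xs @ [xs ! (i - 1) + xs ! i] @ drop (i + 1) xs) = 0"
    if "i \<in> {1..<length xs}" for i
    by (rule zero) (use len that in \<open>auto simp: min_def\<close>)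
  show ?thesis
    unfolding hdiff_def using 1 2 by (simp del: append.simps)
qed (simp add: hdiff_def)

lemma hdiff_diff: "hdiff L (\<phi> - \<psi>) = hdiff L \<phi> - hdiff L \<psi>"
  by (rule ext) (simp add: hdiff_def sum_subtractf algebra_simps)

lemma hdiff_zero: "hdiff L 0 = 0"
  by (rule ext) (simp add: hdiff_def)

lemma perm_eqI_3:
  assumes "p permutes {..<3::nat}" "q permutes {..<3}" "p 0 = q 0" "p 1 = q 1"
  shows "p = q"
proof
  have p2: "p 2 \<in> {..<3} - {p 0, p 1}" if "p permutes {..<3}" for p :: "nat \<Rightarrow> nat"
    using permutes_in_image[OF that, of 2] inj_eq[OF permutes_inj[OF that]] by auto
  have in3: "p 0 < 3" "p 1 < 3" "p 0 \<noteq> p 1"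
    using permutes_in_image[OF assms(1)] inj_eq[OF permutes_inj[OF assms(1)]] by auto
  have "p 2 = q 2"
    using p2[OF assms(1)] p2[OF assms(2)] assms(3,4) in3 by auto
  fix i :: nat
  have "i \<in> {0, 1, 2} \<or> i \<notin> {..<3}" by auto
  then show "p i = q i"
    using assms \<open>p 2 = q 2\<close> permutes_not_in[of p _ i] permutes_not_in[of q _ i] by auto
qed

abbreviation (input) tr :: "nat \<Rightarrow> nat \<Rightarrow> nat \<Rightarrow> nat" where "tr \<equiv> Transposition.transpose"

lemma sum_shuffle_perms_1_2:
  "(\<Sum>p\<in>shuffle_perms 1 2. of_int (sign p) * \<phi> (permute_list (inv p) [x, y]))
     = \<phi> [x, y] - (\<phi> [y, x] :: 'k::field_char_0)"
proof -
  have swap: "tr 0 1 permutes {..<2}" by (rule permutes_swap_id) auto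
  have "p = id \<or> p = tr 0 1" if p: "p permutes {..<2}" for p :: "nat \<Rightarrow> nat"
  proof -
    have *: "p 0 < 2" "p 1 < 2" "p 0 \<noteq> p 1"
      using permutes_in_image[OF p] inj_eq[OF permutes_inj[OF p]] by auto
    have out: "p i = i" if "i \<ge> 2" for i using permutes_not_in[OF p] that by auto
    have cases: "i = 0 \<or> i = 1 \<or> i \<ge> 2" for i :: nat by auto
    show ?thesis
    proof (cases "p 0 = 0")
      case True
      then have "p i = i" for i using * out[of i] cases[of i] by auto
      then show ?thesis by auto
    next
      case False
      then have "p i = tr 0 1 i" for i
        using * out[of i] cases[of i] by (auto simp: Transposition.transpose_def)
      then show ?thesis by auto
    qed
  qed
  then have "shuffle_perms 1 2 = {id, tr 0 1}"
    using swap permutes_id[of "{..<2::nat}"] unfolding shuffle_perms_def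
    by (auto simp: strict_mono_on_def)
  moreover have "id \<noteq> tr 0 1" by (auto dest!: fun_cong[where x = 0])
  moreover have "permute_list (tr 0 1) [x, y] = [y, x]" by (simp add: permute_list_def)
  ultimately show ?thesis
    by (simp add: sign_id sign_swap_id inv_id permute_list_id)
qed

text \<open>
  A shuffle of one letter with two is determined by the place of the single letter. The shuffles
  that are neither the identity nor a transposition are the two 3-cycles, which are inverse
  to each other.
\<close>

lemma sum_shuffle_perms_3:
  fixes \<phi> :: "lattice list \<Rightarrow> 'k::field_char_0"
  shows "(\<Sum>p\<in>shuffle_perms 1 3. of_int (sign p) * \<phi> (permute_list (inv p) [x, y, z]))
     = \<phi> [x, y, z] - \<phi> [y, x, z] + \<phi> [y, z, x]" (is ?A)
  and "(\<Sum>p\<in>shuffle_perms 2 3. of_int (sign p) * \<phi> (permute_list (inv p) [x, y, z]))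
     = \<phi> [x, y, z] - \<phi> [x, z, y] + \<phi> [z, x, y]" (is ?B)
proof -
  define u v where "u = tr 1 2 \<circ> tr 0 1" and "v = tr 0 1 \<circ> tr 1 2"
  have swaps: "tr 0 1 permutes {..<3}" "tr 1 2 permutes {..<3}"
    by (rule permutes_swap_id; simp)+
  then have uv: "u permutes {..<3}" "v permutes {..<3}"
    unfolding u_def v_def by (auto intro: permutes_compose)
  have val: "u 0 = 2" "u 1 = 0" "u 2 = 1" "v 0 = 1" "v 1 = 2" "v 2 = 0"
    by (simp_all add: u_def v_def Transposition.transpose_def)
  have id: "id permutes {..<3::nat}" by (rule permutes_id)
  have inv: "inv u = v" "inv v = u"
    by (rule inv_unique_comp; simp add: u_def v_def fun_eq_iff)+
  have sign: "sign u = 1" "sign v = 1" "sign (tr 0 1) = -1" "sign (tr 1 2) = -1"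
    by (simp_all add: u_def v_def sign_compose permutation_swap_id sign_swap_id)
  have dist: "p 0 < 3" "p 1 < 3" "p 2 < 3" "p 0 \<noteq> p 1" "p 1 \<noteq> p 2" "p 0 \<noteq> p 2"
    if "p permutes {..<3}" for p :: "nat \<Rightarrow> nat"
    using permutes_in_image[OF that, unfolded lessThan_iff] inj_eq[OF permutes_inj[OF that]] by simp_all
  have mono: "strict_mono_on {1..<3} p \<longleftrightarrow> p 1 < p 2" "strict_mono_on {..<2} p \<longleftrightarrow> p 0 < p 1"
    "strict_mono_on {..<1} p" "strict_mono_on {2..<3} p" for p :: "nat \<Rightarrow> nat"
  proof -
    have "{1..<3} = {1, 2::nat}" "{..<2} = {0, 1::nat}" "{..<1} = {0::nat}" "{2..<3} = {2::nat}"
      by auto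
    note * = this
    show "strict_mono_on {1..<3} p \<longleftrightarrow> p 1 < p 2"
      unfolding *(1) strict_mono_on_def by (metis insertE insertI1 insertI2 less_irrefl
          less_asym one_less_numeral_iff semiring_norm(76) singletonD)
    show "strict_mono_on {..<2} p \<longleftrightarrow> p 0 < p 1"
      unfolding *(2) strict_mono_on_def by (metis insertE insertI1 insertI2 less_irrefl
          less_asym less_one singletonD)
    show "strict_mono_on {..<1} p" "strict_mono_on {2..<3} p"
      unfolding * strict_mono_on_def by (metis less_irrefl singletonD)+
  qed
  have "p = id \<or> p = tr 0 1 \<or> p = u" if p: "p permutes {..<3}" "p 1 < p 2" for p
  proof -
    have "(p 0 = 0 \<and> p 1 = 1) \<or> (p 0 = 1 \<and> p 1 = 0) \<or> (p 0 = 2 \<and> p 1 = 0)"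
      using dist[OF p(1)] p(2) by arith
    then show ?thesis
      using perm_eqI_3[OF p(1) id] perm_eqI_3[OF p(1) swaps(1)] perm_eqI_3[OF p(1) uv(1)] val
      by auto
  qed
  then have s1: "shuffle_perms 1 3 = {id, tr 0 1, u}"
    using id swaps uv val unfolding shuffle_perms_def
    by (auto simp: mono mono[unfolded One_nat_def] Transposition.transpose_def)
  have "p = id \<or> p = tr 1 2 \<or> p = v" if p: "p permutes {..<3}" "p 0 < p 1" for p
  proof -
    have "(p 0 = 0 \<and> p 1 = 1) \<or> (p 0 = 0 \<and> p 1 = 2) \<or> (p 0 = 1 \<and> p 1 = 2)"
      using dist[OF p(1)] p(2) by arith
    then show ?thesis
      using perm_eqI_3[OF p(1) id] perm_eqI_3[OF p(1) swaps(2)] perm_eqI_3[OF p(1) uv(2)] val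
      by auto
  qed
  then have s2: "shuffle_perms 2 3 = {id, tr 1 2, v}"
    using id swaps uv val unfolding shuffle_perms_def
    by (auto simp: mono mono[unfolded One_nat_def] Transposition.transpose_def)
  have "id \<noteq> tr 0 1" "id \<noteq> u" "tr 0 1 \<noteq> u" "id \<noteq> v" "tr 1 2 \<noteq> v"
    using val by (auto dest!: fun_cong[where x = 0] simp: Transposition.transpose_def)
  moreover have "id \<noteq> tr 1 2" by (auto dest!: fun_cong[where x = 1])
  moreover have "permute_list (tr 0 1) [x, y, z] = [y, x, z]" "permute_list (tr 1 2) [x, y, z] = [x, z, y]"
    "permute_list v [x, y, z] = [y, z, x]" "permute_list u [x, y, z] = [z, x, y]"
    using val by (simp_all add: permute_list_def numeral_2_eq_2)
  ultimately show ?A ?B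
    unfolding s1 s2 by (simp_all add: sign inv sign_swap_id sign_id inv_id permute_list_id)
qed

lemma cochains_1: "\<phi> \<in> cochains 1 L \<longleftrightarrow> (\<forall>xs. xs \<notin> tuples 1 L \<longrightarrow> \<phi> xs = 0)"
  by (simp add: cochains_def)

text \<open>
  In degree two the only shuffle condition is symmetry.
\<close>

lemma cochains_2:
  "\<phi> \<in> cochains 2 L \<longleftrightarrow> (\<forall>xs. xs \<notin> tuples 2 L \<longrightarrow> \<phi> xs = 0) \<and> (\<forall>x y. \<phi> [x, y] = \<phi> [y, x])"
proof -
  define F where
    "F = (\<lambda>xs. \<Sum>i=1..<2. \<Sum>p\<in>shuffle_perms i 2. of_int (sign p) * \<phi> (permute_list (inv p) xs))"
  have "{1..<2} = {1::nat}" by auto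
  then have F: "F [x, y] = \<phi> [x, y] - \<phi> [y, x]" for x y
    using sum_shuffle_perms_1_2[of \<phi>] by (simp add: F_def)
  have swap: "[y, x] \<in> tuples 2 L \<longleftrightarrow> [x, y] \<in> tuples 2 L" for x y
    by (auto simp: tuples_2 add.commute)
  have cochains: "\<phi> \<in> cochains 2 L
      \<longleftrightarrow> (\<forall>xs. xs \<notin> tuples 2 L \<longrightarrow> \<phi> xs = 0) \<and> (\<forall>xs\<in>tuples 2 L. F xs = 0)"
    by (simp only: cochains_def F_def mem_Collect_eq)
  show ?thesis
  proof
    assume \<phi>: "\<phi> \<in> cochains 2 L"
    have "\<phi> [x, y] = \<phi> [y, x]" for x y
    proof (cases "[x, y] \<in> tuples 2 L")
      case True
      then have "F [x, y] = 0" using \<phi> cochains by blast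
      then show ?thesis by (simp add: F)
    next
      case False
      then show ?thesis using \<phi> swap[of y x] by (simp add: cochains)
    qed
    then show "(\<forall>xs. xs \<notin> tuples 2 L \<longrightarrow> \<phi> xs = 0) \<and> (\<forall>x y. \<phi> [x, y] = \<phi> [y, x])"
      using \<phi> unfolding cochains by blast
  next
    assume *: "(\<forall>xs. xs \<notin> tuples 2 L \<longrightarrow> \<phi> xs = 0) \<and> (\<forall>x y. \<phi> [x, y] = \<phi> [y, x])"
    have "F xs = 0" if xs: "xs \<in> tuples 2 L" for xs
    proof -
      obtain x y where "xs = [x, y]" using xs by (auto simp: tuples_2)
      moreover have "\<phi> [x, y] = \<phi> [y, x]" using * by blast
      ultimately show ?thesis by (simp only: F diff_self)
    qed
    then show "\<phi> \<in> cochains 2 L" using * unfolding cochains by blast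
  qed
qed

text \<open>
  Both shuffle sums of the coboundary of a symmetric cochain cancel separately.
\<close>

lemma hdiff_cochains_3:
  assumes C: "C \<in> cochains 2 L" and add: "\<And>x y. x \<in> L \<Longrightarrow> y \<in> L \<Longrightarrow> x + y \<in> L"
  shows "hdiff L C \<in> cochains 3 L"
proof -
  have 12: "{1..<3} = {1, 2::nat}" by auto
  have sym: "C [x, y] = C [y, x]" and out: "xs \<notin> tuples 2 L \<Longrightarrow> C xs = 0" for x y xs
    using C by (auto simp: cochains_2)
  have "(\<Sum>p\<in>shuffle_perms 1 3. of_int (sign p) * hdiff L C (permute_list (inv p) [x, y, z])) = 0"
    "(\<Sum>p\<in>shuffle_perms 2 3. of_int (sign p) * hdiff L C (permute_list (inv p) [x, y, z])) = 0"
    if "x \<in> L" "y \<in> L" "z \<in> L" for x y z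
    using that sym[of x y] sym[of y z] sym[of x z] sym[of "x + y" z] sym[of "x + z" y] sym[of "y + z" x]
    unfolding sum_shuffle_perms_3 hdiff_3 by (simp_all add: add ac_simps)
  then show ?thesis
    using hdiff_outside[of 2 L C] out unfolding cochains_def 12
    by (auto simp: tuples_3)
qed

lemma hdiff_cochains_2:
  assumes "\<phi> \<in> cochains 1 L"
  shows "hdiff L \<phi> \<in> cochains 2 L"
proof -
  have "hdiff L \<phi> xs = 0" if "xs \<notin> tuples 2 L" for xs
    by (rule hdiff_outside[of 1]; use assms[unfolded cochains_1] that in \<open>simp add: numeral_2_eq_2\<close>)
  then show ?thesis by (auto simp: cochains_2 hdiff_2 add.commute)
qed

lemma hdiff_hdiff_1:
  assumes \<phi>: "\<phi> \<in> cochains 1 L" and add: "\<And>x y. x \<in> L \<Longrightarrow> y \<in> L \<Longrightarrow> x + y \<in> L"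
  shows "hdiff L (hdiff L \<phi>) = 0"
proof
  fix xs
  have out: "hdiff L (hdiff L \<phi>) xs = 0" if "xs \<notin> tuples (Suc 2) L"
    by (rule hdiff_outside[OF _ _ that]) (use hdiff_cochains_2[OF \<phi>] in \<open>auto simp: cochains_2\<close>)
  show "hdiff L (hdiff L \<phi>) xs = 0 xs"
  proof (cases "xs \<in> tuples 3 L")
    case True
    then show ?thesis
      unfolding tuples_3 by (auto simp: hdiff_3 hdiff_2 add add.assoc)
  qed (use out in simp)
qed

lemma hdiff_hdiff_2:
  assumes C: "C \<in> cochains 2 L" and add: "\<And>x y. x \<in> L \<Longrightarrow> y \<in> L \<Longrightarrow> x + y \<in> L"
  shows "hdiff L (hdiff L C) = 0"
proof
  fix xs
  have out: "hdiff L (hdiff L C) xs = 0" if "xs \<notin> tuples (Suc 3) L"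
    by (rule hdiff_outside[OF _ _ that])
      (use hdiff_cochains_3[OF C add] in \<open>auto simp: cochains_def\<close>)
  show "hdiff L (hdiff L C) xs = 0 xs"
  proof (cases "xs \<in> tuples 4 L")
    case True
    then show ?thesis
      unfolding tuples_4 by (auto simp: hdiff_4 hdiff_3 add add.assoc)
  qed (use out in simp)
qed

lemma cochains_diff:
  assumes "\<phi> \<in> cochains m L" "\<psi> \<in> cochains m L"
  shows "\<phi> - \<psi> \<in> cochains m L"
  using assms by (auto simp: cochains_def right_diff_distrib sum_subtractf)

lemma cochains_zero: "0 \<in> cochains m L"
  by (auto simp: cochains_def)

lemma rel_cochains_diff:
  "\<phi> \<in> rel_cochains m L R \<Longrightarrow> \<psi> \<in> rel_cochains m L R \<Longrightarrow> \<phi> - \<psi> \<in> rel_cochains m L R"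
  by (auto simp: rel_cochains_def cochains_diff)

lemma rel_cochains_zero: "0 \<in> rel_cochains m L R"
  by (auto simp: rel_cochains_def cochains_zero)

lemma equiv_cohomologous:
  "equiv (rel_cocycles m L R :: (lattice list \<Rightarrow> 'k::field_char_0) set) (cohomologous m L R)"
  unfolding cohomologous_def
proof (rule equiv_diff_subgroup)
  show "0 \<in> hdiff L ` (rel_cochains (m - 1) L R :: (lattice list \<Rightarrow> 'k) set)"
    by (rule image_eqI[where x = 0]) (simp_all add: hdiff_zero rel_cochains_zero)
qed (auto simp flip: hdiff_diff intro: rel_cochains_diff)

section \<open>Symmetric cocycles on a full cone split\<close>

text \<open>
  A symmetric cocycle is the addition rule of a commutative extension of the monoid \<open>L\<close> by the group
  of values, and a function that splits it amounts to a section of the extension which is a homomorphism.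
  Such a section exists when the group completion of \<open>L\<close> is free: it can be chosen freely on multiples
  of basis vectors, extended to sums of them, and then to differences of such sums.
\<close>

locale symmetric_cocycle =
  fixes L :: "'a::ab_group_add set" and z :: "'a \<Rightarrow> 'a \<Rightarrow> 'b::ab_group_add"
  assumes closed: "\<And>x y. x \<in> L \<Longrightarrow> y \<in> L \<Longrightarrow> x + y \<in> L"
    and zero_mem: "0 \<in> L"
    and sym: "\<And>x y. x \<in> L \<Longrightarrow> y \<in> L \<Longrightarrow> z x y = z y x"
    and cocycle: "\<And>x y w. x \<in> L \<Longrightarrow> y \<in> L \<Longrightarrow> w \<in> L \<Longrightarrow>
      z x y + z (x + y) w = z y w + z x (y + w)"
begin

definition splits :: "'a set \<Rightarrow> ('a \<Rightarrow> 'b) \<Rightarrow> bool" where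
  "splits A E \<longleftrightarrow> (\<forall>x\<in>A. \<forall>y\<in>A. z x y = E x + E y - E (x + y))"

text \<open>
  In the extension this compares \<open>(x + u) + (y + v)\<close> with \<open>(x + y) + (u + v)\<close>.
\<close>

lemma four_term:
  assumes "x \<in> L" "y \<in> L" "u \<in> L" "v \<in> L"
  shows "z x u + z y v + z (x + u) (y + v) = z x y + z u v + z (x + y) (u + v)"
proof -
  have *: "z a c + z b d + z (a + c) (b + d) = z c b + z (c + b) d + z a (c + (b + d))"
    if "a \<in> L" "b \<in> L" "c \<in> L" "d \<in> L" for a b c d
  proof -
    have "z a c + z b d + z (a + c) (b + d) = (z a c + z (a + c) (b + d)) + z b d"
      by (simp add: ac_simps)
    also have "z a c + z (a + c) (b + d) = z c (b + d) + z a (c + (b + d))"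
      using cocycle[of a c "b + d"] closed that by blast
    also have "\<dots> + z b d = (z b d + z c (b + d)) + z a (c + (b + d))"
      by (simp add: ac_simps)
    also have "z b d + z c (b + d) = z c b + z (c + b) d"
      using cocycle[of c b d] that by simp
    finally show ?thesis .
  qed
  have "z u y + z (u + y) v + z x (u + (y + v)) = z y u + z (y + u) v + z x (y + (u + v))"
    using sym assms by (simp add: ac_simps)
  then show ?thesis
    using *[of x y u v] *[of x u y v] assms by simp
qed

text \<open>
  A section over \<open>A\<close> extends to the elements that become elements of \<open>A\<close> after adding an element of \<open>A\<close>:
  the value at \<open>x\<close> is forced by those at \<open>u\<close> and \<open>x + u\<close>.
\<close>

lemma splits_extend:
  assumes E: "splits A E" and A: "A \<subseteq> L" and A_closed: "\<And>x y. x \<in> A \<Longrightarrow> y \<in> A \<Longrightarrow> x + y \<in> A"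
    and reach: "\<And>x. x \<in> L \<Longrightarrow> \<exists>u\<in>A. x + u \<in> A"
  shows "\<exists>E'. splits L E'"
proof -
  define F where "F x u = z x u - E u + E (x + u)" for x u
  obtain u where u: "\<And>x. x \<in> L \<Longrightarrow> u x \<in> A" "\<And>x. x \<in> L \<Longrightarrow> x + u x \<in> A"
    using reach by metis
  have indep: "F x v = F x w" if "x \<in> L" "v \<in> A" "w \<in> A" "x + v \<in> A" "x + w \<in> A" for x v w
  proof -
    have "z (x + v) w = E (x + v) + E w - E (x + v + w)"
      "z (x + w) v = E (x + w) + E v - E (x + w + v)"
      using E that by (auto simp: splits_def)
    then have E: "E (x + v) = z (x + v) w - E w + E (x + v + w)"
      "E (x + w) = z (x + w) v - E v + E (x + w + v)" by (simp_all add: algebra_simps)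
    have "z x v + z (x + v) w = z v w + z x (v + w)"
      "z x w + z (x + w) v = z w v + z x (w + v)" "z v w = z w v"
      by (rule cocycle sym; use that A in blast)+
    then have "z x v + z (x + v) w = z x w + z (x + w) v" by (simp add: add.commute)
    moreover have "F x v = (z x v + z (x + v) w) - E v - E w + E (x + v + w)"
      unfolding F_def E(1) by (simp add: algebra_simps)
    moreover have "F x w = (z x w + z (x + w) v) - E v - E w + E (x + v + w)"
      unfolding F_def E(2) by (simp add: algebra_simps)
    ultimately show ?thesis by simp
  qed
  have "z x y = F x (u x) + F y (u y) - F (x + y) (u (x + y))" if xy: "x \<in> L" "y \<in> L" for x y
  proof -
    have eq: "x + y + (u x + u y) = (x + u x) + (y + u y)" by (simp add: algebra_simps)
    have mem: "x + y + (u x + u y) \<in> A"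
      unfolding eq using A_closed u(2) xy by blast
    have "F (x + y) (u (x + y)) = F (x + y) (u x + u y)"
      by (rule indep) (use xy u closed A_closed mem in blast)+
    moreover have E: "E (u x + u y) = E (u x) + E (u y) - z (u x) (u y)"
      "E (x + u x + (y + u y)) = E (x + u x) + E (y + u y) - z (x + u x) (y + u y)"
      using E u xy by (auto simp: splits_def)
    moreover have "z (x + y) (u x + u y)
        = z x (u x) + z y (u y) + z (x + u x) (y + u y) - z x y - z (u x) (u y)"
      using four_term[of x y "u x" "u y"] xy u A by (simp add: subset_iff algebra_simps)
    ultimately have "F (x + y) (u (x + y)) = z x (u x) + z y (u y) + z (x + u x) (y + u y) - z x y
      - z (u x) (u y) - (E (u x) + E (u y) - z (u x) (u y))
      + (E (x + u x) + E (y + u y) - z (x + u x) (y + u y))"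
      unfolding F_def eq by simp
    then show ?thesis unfolding F_def[of x] F_def[of y] by (simp add: algebra_simps)
  qed
  then have "splits L (\<lambda>x. F x (u x))" unfolding splits_def by simp
  then show ?thesis by (rule exI[where x = "\<lambda>x. F x (u x)"])
qed

lemma splits_direct_sum:
  assumes E: "splits A E" "splits B F" and "A \<subseteq> L" "B \<subseteq> L"
    and p: "\<And>x. x \<in> C \<Longrightarrow> p x \<in> A" and q: "\<And>x. x \<in> C \<Longrightarrow> q x \<in> B"
    and pq: "\<And>x. x \<in> C \<Longrightarrow> x = p x + q x"
    and add: "\<And>x y. p (x + y) = p x + p y" "\<And>x y. q (x + y) = q x + q y"
  shows "splits C (\<lambda>x. E (p x) + F (q x) - z (p x) (q x))"
  unfolding splits_def
proof (intro ballI)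
  fix x y assume xy: "x \<in> C" "y \<in> C"
  have EF: "E (p x + p y) = E (p x) + E (p y) - z (p x) (p y)"
    "F (q x + q y) = F (q x) + F (q y) - z (q x) (q y)"
    using E p q xy by (auto simp: splits_def)
  have "z (p x) (q x) + z (p y) (q y) + z (p x + q x) (p y + q y)
      = z (p x) (p y) + z (q x) (q y) + z (p x + p y) (q x + q y)"
    by (rule four_term) (use p q xy assms(3,4) in blast)+
  then have "z (p x + p y) (q x + q y)
      = z (p x) (q x) + z (p y) (q y) + z x y - z (p x) (p y) - z (q x) (q y)"
    using pq[OF xy(1)] pq[OF xy(2)] by (simp add: algebra_simps)
  then show "z x y = E (p x) + F (q x) - z (p x) (q x) + (E (p y) + F (q y) - z (p y) (q y))
      - (E (p (x + y)) + F (q (x + y)) - z (p (x + y)) (q (x + y)))"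
    unfolding add EF by (simp add: algebra_simps)
qed

text \<open>
  The section takes the multiples of one vector to the multiples of one lift; the lift of \<open>m 1\<close> is the
  one with second coordinate zero.
\<close>

lemma splits_multiples:
  fixes m :: "nat \<Rightarrow> 'a"
  assumes m: "\<And>i. m i \<in> L" "\<And>i j. m (i + j) = m i + m j" and "inj m"
  shows "\<exists>E. splits (range m) E"
proof -
  define S where "S i = z 0 0 - (\<Sum>j<i. z (m j) (m 1))" for i
  have m0: "m 0 = 0" using m(2)[of 0 0] by simp
  have z0: "z x 0 = z 0 0" if "x \<in> L" for x
    using cocycle[OF that zero_mem zero_mem] by simp
  have S: "S (i + j) = S i + S j - z (m i) (m j)" for i j
  proof (induction j)
    case 0
    then show ?case using z0[OF m(1)[of i]] by (simp add: S_def m0)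
  next
    case (Suc j)
    have *: "S (Suc i) = S i - z (m i) (m 1)" for i by (simp add: S_def algebra_simps)
    have "z (m i) (m j) + z (m i + m j) (m 1) = z (m j) (m 1) + z (m i) (m j + m 1)"
      by (rule cocycle) (use m in auto)
    then have z: "z (m i) (m (Suc j)) = z (m i) (m j) + z (m (i + j)) (m 1) - z (m j) (m 1)"
      using m(2)[of i j] m(2)[of j 1] by (simp add: algebra_simps)
    have "S (i + Suc j) = S i + S j - z (m i) (m j) - z (m (i + j)) (m 1)"
      using Suc *[of "i + j"] by simp
    then show ?case unfolding z *[of j] by (simp add: algebra_simps)
  qed
  have "splits (range m) (\<lambda>x. S (inv m x))"
    unfolding splits_def
  proof (intro ballI)
    fix x y assume "x \<in> range m" "y \<in> range m"
    then obtain i j where "x = m i" "y = m j" by blast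
    then show "z x y = S (inv m x) + S (inv m y) - S (inv m (x + y))"
      using S[of i j] \<open>inj m\<close> by (simp flip: m(2))
  qed
  then show ?thesis by blast
qed

end

lemma vec3_eq_iff: "x = y \<longleftrightarrow> x $ 1 = y $ 1 \<and> x $ 2 = y $ 2 \<and> x $ 3 = (y :: 'r^3) $ 3"
  by (simp add: vec_eq_iff forall_3)

lemma Rstar_nth: "Rstar $ 1 = 0" "Rstar $ 2 = 0" "Rstar $ 3 = 1"
  by (simp_all add: Rstar_def axis_def)

text \<open>
  Adding a multiple of \<open>R\<^sup>*\<close> moves the first two unit vectors into \<open>L\<close>. With \<open>R\<^sup>*\<close> they still form
  a basis of the lattice, and every vector is a difference of two vectors of the monoid \<open>C\<close> that the
  basis generates.
\<close>

lemma symmetric_cocycle_on_cone_splits: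
  fixes L :: "lattice set" and z :: "lattice \<Rightarrow> lattice \<Rightarrow> 'b::ab_group_add"
  assumes "symmetric_cocycle L z" and reach: "\<And>m. \<exists>c. m + c *s Rstar \<in> L"
    and R: "Rstar \<in> L"
  shows "\<exists>E. \<forall>x\<in>L. \<forall>y\<in>L. z x y = E x + E y - E (x + y)"
proof -
  interpret symmetric_cocycle L z by fact
  obtain c1 where c1: "axis 1 1 + c1 *s Rstar \<in> L" using reach by blast
  obtain c2 where c2: "axis 2 1 + c2 *s Rstar \<in> L" using reach by blast
  define e1 e2 where "e1 = axis 1 1 + c1 *s Rstar" and "e2 = axis 2 1 + c2 *s Rstar"
  have e: "e1 $ 1 = 1" "e1 $ 2 = 0" "e1 $ 3 = c1" "e2 $ 1 = 0" "e2 $ 2 = 1" "e2 $ 3 = c2"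
    by (simp_all add: e1_def e2_def axis_def Rstar_nth)
  have mult: "int i *s v \<in> L" if "v \<in> L" for i v
  proof (induction i)
    case 0 show ?case using zero_mem by simp
  next
    case (Suc i)
    have "int (Suc i) *s v = v + int i *s v" by (simp add: vec_eq_iff algebra_simps)
    then show ?case using closed[OF that Suc] by simp
  qed
  have line: "\<exists>E. splits (range (\<lambda>i. int i *s v)) E" if "v \<in> L" "v \<noteq> 0" for v
    by (rule splits_multiples) (use mult that in \<open>auto simp: inj_def vec_eq_iff algebra_simps\<close>)
  \<comment> \<open>The three coordinates with respect to the basis \<open>e1\<close>, \<open>e2\<close>, \<open>Rstar\<close> are \<open>m $ 1\<close>, \<open>m $ 2\<close> and \<open>l3 m\<close>.\<close>
  define l3 where "l3 m = m $ 3 - c1 * m $ 1 - c2 * m $ 2" for m :: lattice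
  define p1 p2 p3 where "p1 m = m $ 1 *s e1" and "p2 m = m $ 2 *s e2" and "p3 m = l3 m *s Rstar"
    for m
  define C where "C = {m. m $ 1 \<ge> 0 \<and> m $ 2 \<ge> 0 \<and> l3 m \<ge> 0}"
  define C12 where "C12 = {m. m $ 1 \<ge> 0 \<and> m $ 2 \<ge> 0 \<and> l3 m = 0}"
  have dec: "m = p1 m + p2 m + p3 m" for m
    by (simp add: vec3_eq_iff p1_def p2_def p3_def l3_def e Rstar_nth algebra_simps)
  have add: "p1 (x + y) = p1 x + p1 y" "p2 (x + y) = p2 x + p2 y" "p3 (x + y) = p3 x + p3 y" for x y
    by (simp_all add: p1_def p2_def p3_def l3_def vec_eq_iff algebra_simps)
  have rng: "k *s v \<in> range (\<lambda>i. int i *s v)" if "k \<ge> 0" for k and v :: lattice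
    using that by (metis nonneg_int_cases rangeI)
  have ne: "e1 \<noteq> 0" "e2 \<noteq> 0" "Rstar \<noteq> 0" using e Rstar_nth by (auto simp: vec3_eq_iff)
  have eL: "e1 \<in> L" "e2 \<in> L" using c1 c2 by (simp_all add: e1_def e2_def)
  obtain E1 where E1: "splits (range (\<lambda>i. int i *s e1)) E1" using line eL(1) ne(1) by blast
  obtain E2 where E2: "splits (range (\<lambda>i. int i *s e2)) E2" using line eL(2) ne(2) by blast
  obtain E3 where E3: "splits (range (\<lambda>i. int i *s Rstar)) E3" using line R ne(3) by blast
  have sub: "range (\<lambda>i. int i *s v) \<subseteq> L" if "v \<in> L" for v using mult that by blast
  have CL: "C \<subseteq> L"
  proof
    fix m assume "m \<in> C"
    then have "p1 m \<in> L" "p2 m \<in> L" "p3 m \<in> L"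
      using rng sub eL R unfolding C_def p1_def p2_def p3_def by blast+
    then show "m \<in> L" using dec[of m] closed by metis
  qed
  have "C12 \<subseteq> C" by (auto simp: C12_def C_def)
  have E12: "splits C12 (\<lambda>x. E1 (p1 x) + E2 (p2 x) - z (p1 x) (p2 x))"
  proof (rule splits_direct_sum[OF E1 E2])
    show "x = p1 x + p2 x" if "x \<in> C12" for x
      using dec[of x] that by (simp add: C12_def p3_def)
    show "p1 x \<in> range (\<lambda>i. int i *s e1)" "p2 x \<in> range (\<lambda>i. int i *s e2)" if "x \<in> C12" for x
      using that rng unfolding p1_def p2_def C12_def by blast+
  qed (use sub eL add in blast)+
  obtain E where E: "splits C E"
  proof (rule that, rule splits_direct_sum[OF E12 E3])
    show "p1 x + p2 x \<in> C12" if "x \<in> C" for x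
      using that by (simp add: C12_def C_def l3_def p1_def p2_def e)
    show "p3 x \<in> range (\<lambda>i. int i *s Rstar)" if "x \<in> C" for x
      using that rng unfolding p3_def C_def by blast
    show "p1 (x + y) + p2 (x + y) = p1 x + p2 x + (p1 y + p2 y)" for x y
      by (simp add: add ac_simps)
    show "x = p1 x + p2 x + p3 x" for x by (rule dec)
  qed (use \<open>C12 \<subseteq> C\<close> CL sub R add in blast)+
  have "\<exists>E'. splits L E'"
  proof (rule splits_extend[OF E CL])
    show "x + y \<in> C" if "x \<in> C" "y \<in> C" for x y
    proof -
      have "l3 (x + y) = l3 x + l3 y" by (simp add: l3_def algebra_simps)
      then show ?thesis using that by (simp add: C_def)
    qed
    show "\<exists>u\<in>C. x + u \<in> C" for x
    proof -
      define u where "u = \<bar>x $ 1\<bar> *s e1 + \<bar>x $ 2\<bar> *s e2 + \<bar>l3 x\<bar> *s Rstar"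
      have "u $ 1 = \<bar>x $ 1\<bar>" "u $ 2 = \<bar>x $ 2\<bar>" "l3 u = \<bar>l3 x\<bar>"
        by (simp_all add: u_def e Rstar_nth l3_def)
      moreover have "l3 (x + u) = l3 x + l3 u" by (simp add: l3_def algebra_simps)
      ultimately have "u \<in> C" "x + u \<in> C" by (auto simp: C_def abs_if)
      then show ?thesis by blast
    qed
  qed
  then show ?thesis by (simp add: splits_def)
qed

section \<open>The cone over a lattice polygon\<close>

lemma pairing_3: "pairing b m = b $ 1 * m $ 1 + b $ 2 * m $ 2 + b $ 3 * m $ 3"
  by (simp add: pairing_def sum_3)

lemma pairing_simps:
  "pairing b (x + y) = pairing b x + pairing b y"
  "pairing b (x - y) = pairing b x - pairing b y"
  "pairing b (- x) = - pairing b x"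
  "pairing b (c *s x) = c * pairing b x"
  "pairing b 0 = 0"
  "pairing (b + b') x = pairing b x + pairing b' x"
  "pairing (b - b') x = pairing b x - pairing b' x"
  "pairing (- b) x = - pairing b x"
  "pairing (c *s b) x = c * pairing b x"
  "pairing 0 x = 0"
  by (simp_all add: pairing_3 algebra_simps)

lemma pairing_sum_left: "pairing (\<Sum>i\<in>I. b i) x = (\<Sum>i\<in>I. pairing (b i) x)"
  by (induction I rule: infinite_finite_induct) (simp_all add: pairing_simps)

lemma kvec_nth: "kvec v $ i = of_int (v $ i)"
  by (simp add: kvec_def)

lemma kvec_simps:
  "kvec (x + y) = kvec x + kvec y" "kvec (x - y) = kvec x - kvec y" "kvec (- x) = - kvec x"
  "kvec (c *s x) = of_int c *s kvec x" "kvec 0 = 0"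
  by (simp_all add: vec_eq_iff kvec_nth)

lemma pairing_kvec: "pairing (kvec b) (kvec m) = of_int (pairing b m)"
  by (simp add: pairing_3 kvec_nth)

lemma kvec_eq_iff: "kvec x = (kvec y :: 'k::ring_char_0^3) \<longleftrightarrow> x = y"
  by (simp add: vec_eq_iff kvec_nth)

lemma pairing_Rstar: "pairing b Rstar = b $ 3"
  by (simp add: pairing_3 Rstar_nth)

lemma pairing_kvec_Rstar: "pairing b (kvec Rstar) = b $ 3"
  by (simp add: pairing_3 Rstar_nth kvec_nth)

text \<open>
  For \<open>v\<close> and \<open>w\<close> with third coordinate one this is their cross product.
\<close>

definition edge_cross :: "lattice \<Rightarrow> lattice \<Rightarrow> lattice" where
  "edge_cross v w = vector [- (w $ 2 - v $ 2), w $ 1 - v $ 1,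
     (w $ 2 - v $ 2) * v $ 1 - (w $ 1 - v $ 1) * v $ 2]"

lemma edge_cross_nth:
  "edge_cross v w $ 1 = - (w $ 2 - v $ 2)" "edge_cross v w $ 2 = w $ 1 - v $ 1"
  "edge_cross v w $ 3 = (w $ 2 - v $ 2) * v $ 1 - (w $ 1 - v $ 1) * v $ 2"
  by (simp_all add: edge_cross_def)

locale lattice_cone =
  fixes n :: nat and a :: "nat \<Rightarrow> lattice"
  assumes polygon: "lattice_polygon n a"
begin

abbreviation "L \<equiv> Lam n a"

lemma n_ge: "n \<ge> 3" and inj_a: "inj_on a {..<n}" and a3: "j < n \<Longrightarrow> a j $ 3 = 1"
  using polygon by (auto simp: lattice_polygon_def)

lemma nxt_less: "nxt n j < n"
  using n_ge by (simp add: nxt_def)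

lemma nxt_neq: "j < n \<Longrightarrow> nxt n j \<noteq> j" and nxt_nxt_neq: "j < n \<Longrightarrow> nxt n (nxt n j) \<noteq> j"
  using n_ge by (auto simp: nxt_def mod_Suc)

lemma nxt_inj: "i < n \<Longrightarrow> j < n \<Longrightarrow> nxt n i = nxt n j \<longleftrightarrow> i = j"
  using n_ge by (auto simp: nxt_def mod_Suc split: if_splits)

lemma obtain_prev:
  assumes "j < n"
  obtains i where "i < n" "nxt n i = j"
proof (rule that)
  show "(if j = 0 then n - 1 else j - 1) < n" "nxt n (if j = 0 then n - 1 else j - 1) = j"
    using assms by (auto simp: nxt_def)
qed

lemma bij_nxt: "bij_betw (nxt n) {..<n} {..<n}"
  by (rule bij_betw_imageI) (use nxt_inj nxt_less in \<open>auto simp: inj_on_def elim: obtain_prev\<close>)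

lemma sum_nxt: "(\<Sum>j<n. f (nxt n j)) = (\<Sum>j<n. f j)"
  by (rule sum.reindex_bij_betw[OF bij_nxt])

lemma pairing_a_Rstar: "j < n \<Longrightarrow> pairing (a j) Rstar = 1"
  by (simp add: pairing_Rstar a3)

lemma edge_vec_nth: "j < n \<Longrightarrow> edge_vec n a j $ 3 = 0"
  using a3 nxt_less by (simp add: edge_vec_def)

lemma Lam_iff: "r \<in> L \<longleftrightarrow> (\<forall>j<n. 0 \<le> pairing (a j) r)"
proof
  assume "r \<in> L"
  moreover have "kvec (a j) \<in> cone_over n a" if "j < n" for j
    unfolding cone_over_def polygon_def using that by (intro hull_inc) auto
  ultimately show "\<forall>j<n. 0 \<le> pairing (a j) r"
    unfolding Lam_def by (metis (mono_tags, lifting) mem_Collect_eq of_int_0_le_iff pairing_kvec)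
next
  assume r: "\<forall>j<n. 0 \<le> pairing (a j) r"
  have inner: "pairing x (kvec r) = kvec r \<bullet> x" for x :: "real^3"
    by (simp add: pairing_3 inner_vec_def sum_3 algebra_simps)
  have nonneg: "0 \<le> kvec r \<bullet> (kvec (a j) :: real^3)" if "j < n" for j
    using r that inner[of "kvec (a j)"] by (metis of_int_0_le_iff pairing_kvec)
  have "cone_over n a \<subseteq> {x. kvec r \<bullet> x \<ge> 0}"
    unfolding cone_over_def
  proof (rule hull_minimal)
    show "convex_cone {x :: real^3. kvec r \<bullet> x \<ge> 0}"
      by (rule convex_cone_halfspace_ge)
    show "polygon n a \<subseteq> {x. kvec r \<bullet> x \<ge> 0}"
      unfolding polygon_def
    proof (rule hull_minimal)
      show "(\<lambda>j. kvec (a j)) ` {..<n} \<subseteq> {x :: real^3. kvec r \<bullet> x \<ge> 0}"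
        using nonneg by auto
    qed (rule convex_halfspace_ge)
  qed
  then show "r \<in> L" unfolding Lam_def by (auto simp: inner)
qed

lemma Lam_add: "x \<in> L \<Longrightarrow> y \<in> L \<Longrightarrow> x + y \<in> L"
  by (simp add: Lam_iff pairing_simps)

lemma Lam_zero: "0 \<in> L"
  by (simp add: Lam_iff pairing_simps)

lemma Rstar_mem: "Rstar \<in> L"
  by (simp add: Lam_iff pairing_a_Rstar)

text \<open>
  Faces of polytopes are exposed. The line through an edge contains no vertex besides the two end points,
  because such a vertex would lie inside the edge and hence not be extreme.
\<close>

lemma edge_supporting_line:
  assumes j: "j < n"
  obtains c :: "real^3" and \<beta> where "\<And>i. i < n \<Longrightarrow> c \<bullet> kvec (a i) \<le> \<beta>"
    "\<And>i. i < n \<Longrightarrow> c \<bullet> kvec (a i) = \<beta> \<longleftrightarrow> i = j \<or> i = nxt n j"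
proof -
  let ?P = "polygon n a" and ?v = "\<lambda>i. kvec (a i) :: real^3"
  let ?s = "closed_segment (?v j) (?v (nxt n j))"
  have "polyhedron ?P"
    unfolding polygon_def by (intro polytope_imp_polyhedron polytope_convex_hull) simp
  moreover have "?s face_of ?P"
    using polygon j unfolding lattice_polygon_def by (auto simp: edge_of_def)
  ultimately have "?s exposed_face_of ?P"
    by (simp add: exposed_face_of_polyhedron)
  then obtain c \<beta> where c: "?P \<subseteq> {x. c \<bullet> x \<le> \<beta>}" "?s = ?P \<inter> {x. c \<bullet> x = \<beta>}"
    unfolding exposed_face_of_def by blast
  have vP: "?v i \<in> ?P" if "i < n" for i
    unfolding polygon_def using that by (intro hull_inc) auto
  have "i = j \<or> i = nxt n j" if i: "i < n" "?v i \<in> ?s" for i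
  proof -
    have "?v i extreme_point_of ?P"
      using polygon i(1) unfolding lattice_polygon_def by blast
    then have "?v i \<notin> open_segment (?v j) (?v (nxt n j))"
      using vP[OF j] vP[OF nxt_less] unfolding extreme_point_of_def by blast
    then have "a i = a j \<or> a i = a (nxt n j)"
      using i(2) by (auto simp: open_segment_def kvec_eq_iff)
    then show ?thesis using inj_a i(1) j nxt_less by (auto simp: inj_on_def)
  qed
  moreover have "?v j \<in> ?s" "?v (nxt n j) \<in> ?s" by auto
  ultimately show ?thesis
    using c vP by (intro that[of c \<beta>]) blast+
qed

lemma edge_neq:
  assumes "j < n"
  shows "edge_vec n a j $ 1 \<noteq> 0 \<or> edge_vec n a j $ 2 \<noteq> 0"
proof (rule ccontr)
  assume "\<not> ?thesis"
  then have "a (nxt n j) = a j"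
    using edge_vec_nth[OF assms] by (simp add: edge_vec_def vec3_eq_iff)
  then show False
    using inj_a assms nxt_less nxt_neq[OF assms] by (auto simp: inj_on_def)
qed

text \<open>
  The vertices may be listed in either orientation, so the sign of the inner normal of an edge is chosen
  by its values on the polygon.
\<close>

definition normal :: "nat \<Rightarrow> lattice" where
  "normal j = (let v = edge_cross (a j) (a (nxt n j)) in if \<forall>i<n. 0 \<le> pairing (a i) v then v else - v)"

lemma normal_cases:
  "normal j = edge_cross (a j) (a (nxt n j)) \<or> normal j = - edge_cross (a j) (a (nxt n j))"
  by (simp add: normal_def Let_def)

text \<open>
  Up to a factor that does not depend on the vertex, the cross product evaluates at each
  vertex to its distance from the supporting line of the edge. The factor is not zero, because some vertex is
  off the edge.
\<close>

lemma normal: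
  assumes j: "j < n" and i: "i < n"
  shows normal_nonneg: "0 \<le> pairing (a i) (normal j)"
    and normal_zero_iff: "pairing (a i) (normal j) = 0 \<longleftrightarrow> i = j \<or> i = nxt n j"
proof -
  obtain c :: "real^3" and \<beta> where le: "\<And>i. i < n \<Longrightarrow> c \<bullet> kvec (a i) \<le> \<beta>"
    and eq: "\<And>i. i < n \<Longrightarrow> c \<bullet> kvec (a i) = \<beta> \<longleftrightarrow> i = j \<or> i = nxt n j"
    using edge_supporting_line[OF j] by blast
  define v where "v = edge_cross (a j) (a (nxt n j))"
  define x y :: "nat \<Rightarrow> real" where "x i = a i $ 1" and "y i = a i $ 2" for i
  define dx dy where "dx = x (nxt n j) - x j" and "dy = y (nxt n j) - y j"
  define D where "D i = dx * (y i - y j) - dy * (x i - x j)" for i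
  have pv: "real_of_int (pairing (a i) v) = D i" if "i < n" for i
    using a3[OF that]
    by (simp add: v_def pairing_3 edge_cross_nth D_def dx_def dy_def x_def y_def algebra_simps)
  have c3: "c \<bullet> kvec (a i) = c $ 1 * x i + c $ 2 * y i + c $ 3" if "i < n" for i
    using a3[OF that] by (simp add: inner_vec_def sum_3 kvec_nth x_def y_def)
  define \<kappa> where "\<kappa> = dy * c $ 1 - dx * c $ 2"
  have d: "dx\<^sup>2 + dy\<^sup>2 > 0"
    using edge_neq[OF j] by (auto simp: dx_def dy_def x_def y_def edge_vec_def sum_power2_gt_zero_iff)
  have \<kappa>: "\<kappa> * D i = (dx\<^sup>2 + dy\<^sup>2) * (\<beta> - c \<bullet> kvec (a i))" if i: "i < n" for i
  proof -
    have 0: "c $ 1 * dx + c $ 2 * dy = 0"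
      using eq[OF j] eq[OF nxt_less, of j] c3[OF j] c3[OF nxt_less, of j]
      by (simp add: dx_def dy_def algebra_simps)
    have 1: "\<beta> - c \<bullet> kvec (a i) = - (c $ 1 * (x i - x j) + c $ 2 * (y i - y j))"
      using eq[OF j] c3[OF j] c3[OF i] by (simp add: algebra_simps)
    have "\<kappa> * D i + (dx\<^sup>2 + dy\<^sup>2) * (c $ 1 * (x i - x j) + c $ 2 * (y i - y j))
        = (c $ 1 * dx + c $ 2 * dy) * (dx * (x i - x j) + dy * (y i - y j))"
      unfolding \<kappa>_def D_def by (simp add: power2_eq_square algebra_simps)
    then show ?thesis unfolding 0 1 by (simp add: algebra_simps)
  qed
  \<comment> \<open>a vertex off the edge, to exclude \<open>\<kappa> = 0\<close>\<close>
  have "\<exists>i<n. i \<noteq> j \<and> i \<noteq> nxt n j"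
  proof (rule ccontr)
    assume "\<not> ?thesis"
    then have "{..<n} \<subseteq> {j, nxt n j}" by auto
    then have "card {..<n} \<le> card {j, nxt n j}" by (rule card_mono[rotated]) simp
    also have "\<dots> \<le> 2" by (simp add: card_insert_if)
    finally show False using n_ge by simp
  qed
  then obtain k where k: "k < n" "k \<noteq> j" "k \<noteq> nxt n j" by blast
  have pos: "\<beta> - c \<bullet> kvec (a k) > 0"
    using le[OF k(1)] eq[OF k(1)] k by (simp add: less_le)
  then have "\<kappa> * D k > 0" using \<kappa>[OF k(1)] d by (simp add: zero_less_mult_iff)
  then have "\<kappa> \<noteq> 0" by auto
  have nonneg: "\<kappa> * D i \<ge> 0" if "i < n" for i
    using \<kappa>[OF that] d le[OF that] by simp
  have zero: "D i = 0 \<longleftrightarrow> i = j \<or> i = nxt n j" if "i < n" for i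
    using \<kappa>[OF that] d eq[OF that] \<open>\<kappa> \<noteq> 0\<close> by auto
  have D0: "pairing (a i) v = 0 \<longleftrightarrow> D i = 0"
    using pv[OF i] by (metis of_int_eq_0_iff)
  show "pairing (a i) (normal j) = 0 \<longleftrightarrow> i = j \<or> i = nxt n j"
    using zero[OF i] D0 normal_cases[of j] unfolding v_def[symmetric] by (auto simp: pairing_simps)
  show "0 \<le> pairing (a i) (normal j)"
  proof (cases "\<kappa> > 0")
    case True
    then have "0 \<le> pairing (a i) v" if "i < n" for i
      using nonneg[OF that] pv[OF that] by (metis of_int_0_le_iff zero_le_mult_iff not_less)
    then show ?thesis using i unfolding normal_def v_def[symmetric] Let_def by simp
  next
    case False
    then have \<kappa>: "\<kappa> < 0" using \<open>\<kappa> \<noteq> 0\<close> by simp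
    then have le0: "pairing (a i) v \<le> 0" if "i < n" for i
      using nonneg[OF that] pv[OF that] by (metis of_int_le_0_iff zero_le_mult_iff not_less)
    have "D k < 0" using \<open>\<kappa> * D k > 0\<close> \<kappa> by (simp add: zero_less_mult_iff)
    then have "pairing (a k) v < 0" using pv[OF k(1)] by simp
    then show ?thesis
      using le0[OF i] k(1) unfolding normal_def v_def[symmetric] Let_def
      by (auto simp: pairing_simps not_le)
  qed
qed

lemma normal_mem: "j < n \<Longrightarrow> normal j \<in> L"
  by (simp add: Lam_iff normal_nonneg)

text \<open>
  Three vertices, two of which span an edge, are linearly independent: the inner normal of the edge shows
  that their determinant is not zero.
\<close>

lemma vanish_at_three_vertices:
  assumes j: "j < n" and i: "i < n" "i \<noteq> j" "i \<noteq> nxt n j"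
    and w: "pairing (a j) w = 0" "pairing (a (nxt n j)) w = 0" "pairing (a i) w = 0"
  shows "w = 0"
proof -
  define x y where "x k = a k $ 1 - a j $ 1" and "y k = a k $ 2 - a j $ 2" for k
  let ?p = "nxt n j"
  define D where "D = x ?p * y i - y ?p * x i"
  have "pairing (a i) (edge_cross (a j) (a ?p)) = D"
    using a3[OF i(1)] by (simp add: pairing_3 edge_cross_nth D_def x_def y_def algebra_simps)
  moreover have "pairing (a i) (normal j) \<noteq> 0" using normal_zero_iff[OF j i(1)] i by simp
  ultimately have D: "D \<noteq> 0" using normal_cases[of j] by (auto simp: pairing_simps)
  have 0: "w $ 1 * x ?p + w $ 2 * y ?p = 0" "w $ 1 * x i + w $ 2 * y i = 0"
    using w a3[OF j] a3[OF i(1)] a3[OF nxt_less, of j]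
    by (simp_all add: pairing_3 x_def y_def algebra_simps)
  have "w $ 1 * D = y i * (w $ 1 * x ?p + w $ 2 * y ?p) - y ?p * (w $ 1 * x i + w $ 2 * y i)"
    "w $ 2 * D = x ?p * (w $ 1 * x i + w $ 2 * y i) - x i * (w $ 1 * x ?p + w $ 2 * y ?p)"
    unfolding D_def by (simp_all add: algebra_simps)
  then have "w $ 1 = 0" "w $ 2 = 0" unfolding 0 using D by simp_all
  moreover have "w $ 3 = 0" using calculation w(1) a3[OF j] by (simp add: pairing_3)
  ultimately show ?thesis by (simp add: vec3_eq_iff)
qed

text \<open>
  A function that vanishes at the vertex \<open>i\<close> is a combination of the inner normals of the two edges at
  \<open>i\<close>. If it is nonnegative at the two neighbours of \<open>i\<close>, the coefficients are nonnegative, and both normals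
  are positive at \<open>j\<close>.
\<close>

lemma vanish_at_nonadjacent_vertices:
  assumes r: "r \<in> L" and i: "i < n" and j: "j < n" and ij: "i \<noteq> j" "j \<noteq> nxt n i" "i \<noteq> nxt n j"
    and zero: "pairing (a i) r = 0" "pairing (a j) r = 0"
  shows "r = 0"
proof -
  obtain l where l: "l < n" "nxt n l = i" using obtain_prev[OF i] .
  define p where "p = nxt n i"
  have p: "p < n" by (simp add: p_def nxt_less)
  have ne: "l \<noteq> i" "l \<noteq> p" "l \<noteq> j" "p \<noteq> i"
    using nxt_neq[OF l(1)] nxt_nxt_neq[OF l(1)] nxt_neq[OF i] l ij by (auto simp: p_def)
  define s t where "s = pairing (a l) (normal i)" and "t = pairing (a p) (normal l)"
  have st: "s > 0" "t > 0"
    using normal_nonneg[OF i l(1)] normal_zero_iff[OF i l(1)] normal_nonneg[OF l(1) p]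
      normal_zero_iff[OF l(1) p] ne l(2) by (auto simp: s_def t_def p_def less_le)
  define A B where "A = pairing (a l) r * t" and "B = pairing (a p) r * s"
  have AB: "A \<ge> 0" "B \<ge> 0"
    using r l(1) p st by (auto simp: A_def B_def Lam_iff)
  have n0: "pairing (a i) (normal i) = 0" "pairing (a p) (normal i) = 0"
    "pairing (a i) (normal l) = 0" "pairing (a l) (normal l) = 0"
    using normal_zero_iff[OF i] normal_zero_iff[OF l(1)] i p l by (auto simp: p_def)
  \<comment> \<open>\<open>s * t\<close> clears the denominators of the coefficients \<open>A\<close> and \<open>B\<close>.\<close>
  define w where "w = (s * t) *s r - A *s normal i - B *s normal l"
  have "w = 0"
    by (rule vanish_at_three_vertices[OF i l(1)])
      (use n0 ne zero in \<open>simp_all add: w_def pairing_simps A_def B_def flip: p_def s_def t_def\<close>)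
  then have "pairing (a j) w = 0" by (simp add: pairing_simps)
  then have sum0: "A * pairing (a j) (normal i) + B * pairing (a j) (normal l) = 0"
    using zero by (simp add: w_def pairing_simps)
  have pos: "pairing (a j) (normal i) > 0" "pairing (a j) (normal l) > 0"
    using normal_nonneg[OF i j] normal_zero_iff[OF i j] normal_nonneg[OF l(1) j]
      normal_zero_iff[OF l(1) j] ne ij l(2) by (auto simp: less_le)
  have "A = 0" "B = 0"
    using sum0 AB pos by (auto simp: add_nonneg_eq_0_iff)
  then have "pairing (a l) r = 0" "pairing (a p) r = 0"
    using st by (auto simp: A_def B_def)
  then show "r = 0"
    using vanish_at_three_vertices[OF i l(1) ne(1)] ne zero by (auto simp: p_def)
qed

text \<open>
  The sum of the inner normals of the two edges at the vertex.
\<close>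

lemma vertex_interior:
  assumes j: "j < n"
  obtains f where "\<And>i. i < n \<Longrightarrow> 0 \<le> pairing (a i) f" "\<And>i. i < n \<Longrightarrow> pairing (a i) f = 0 \<longleftrightarrow> i = j"
proof -
  obtain l where l: "l < n" "nxt n l = j" using obtain_prev[OF j] .
  have "nxt n j \<noteq> l" using nxt_nxt_neq[OF l(1)] l by simp
  then show ?thesis
    using normal_nonneg[OF j] normal_nonneg[OF l(1)] normal_zero_iff[OF j] normal_zero_iff[OF l(1)] l(2)
    by (intro that[of "normal j + normal l"]) (auto simp: pairing_simps add_nonneg_eq_0_iff)
qed

lemma eventually_in_cone:
  assumes "\<And>i. i < n \<Longrightarrow> pairing (a i) f > 0 \<or> pairing (a i) f = 0 \<and> pairing (a i) m \<ge> 0"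
  shows "\<exists>c\<ge>0. \<forall>c'\<ge>c. m + c' *s f \<in> L"
proof (intro exI conjI allI impI)
  let ?c = "\<Sum>i<n. \<bar>pairing (a i) m\<bar>"
  show "?c \<ge> 0" by (simp add: sum_nonneg)
  fix c' assume c': "c' \<ge> ?c"
  then have "c' \<ge> 0" using \<open>?c \<ge> 0\<close> by linarith
  have "0 \<le> pairing (a i) m + c' * pairing (a i) f" if i: "i < n" for i
  proof (cases "pairing (a i) f > 0")
    case True
    have "\<bar>pairing (a i) m\<bar> \<le> ?c" by (rule member_le_sum) (use i in auto)
    then have "\<bar>pairing (a i) m\<bar> \<le> c'" using c' by simp
    also have "c' \<le> c' * pairing (a i) f"
      using True \<open>c' \<ge> 0\<close> by (simp add: mult_le_cancel_left1)
    finally show ?thesis by linarith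
  qed (use assms[OF i] in auto)
  then show "m + c' *s f \<in> L" by (simp add: Lam_iff pairing_simps)
qed

end

section \<open>Additive functions on the sets K\<close>

lemma H1_iff:
  "\<phi> \<in> H1 Q \<longleftrightarrow> \<phi> \<in> cochains 1 Q
     \<and> (\<forall>x y. x \<in> Q \<longrightarrow> y \<in> Q \<longrightarrow> x + y \<in> Q \<longrightarrow> \<phi> [x + y] = \<phi> [x] + \<phi> [y])"
proof -
  have "hdiff Q \<phi> = 0
      \<longleftrightarrow> (\<forall>x y. x \<in> Q \<longrightarrow> y \<in> Q \<longrightarrow> x + y \<in> Q \<longrightarrow> \<phi> [x + y] = \<phi> [x] + \<phi> [y])"
    if "\<phi> \<in> cochains 1 Q"
  proof
    assume zero: "hdiff Q \<phi> = 0"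
    have "hdiff Q \<phi> [x, y] = 0" for x y by (simp add: zero)
    then show "\<forall>x y. x \<in> Q \<longrightarrow> y \<in> Q \<longrightarrow> x + y \<in> Q \<longrightarrow> \<phi> [x + y] = \<phi> [x] + \<phi> [y]"
      unfolding hdiff_2 by (metis eq_iff_diff_eq_0)
  next
    assume add: "\<forall>x y. x \<in> Q \<longrightarrow> y \<in> Q \<longrightarrow> x + y \<in> Q \<longrightarrow> \<phi> [x + y] = \<phi> [x] + \<phi> [y]"
    show "hdiff Q \<phi> = 0"
    proof
      fix xs
      show "hdiff Q \<phi> xs = 0 xs"
      proof (cases "xs \<in> tuples 2 Q")
        case True
        then show ?thesis using add by (auto simp: tuples_2 hdiff_2)
      next
        case False
        then show ?thesis using hdiff_cochains_2[OF that] by (simp add: cochains_2)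
      qed
    qed
  qed
  then show ?thesis unfolding H1_def by blast
qed

definition fun_cochain :: "lattice set \<Rightarrow> (lattice \<Rightarrow> 'k::field_char_0) \<Rightarrow> lattice list \<Rightarrow> 'k" where
  "fun_cochain Q f = (\<lambda>xs. if xs \<in> tuples 1 Q then f (hd xs) else 0)"

lemma fun_cochain: "fun_cochain Q f \<in> cochains 1 Q" "x \<in> Q \<Longrightarrow> fun_cochain Q f [x] = f x"
  unfolding cochains_1 fun_cochain_def tuples_1 by auto

lemma cochains_1_mono: "\<phi> \<in> cochains 1 Q \<Longrightarrow> Q \<subseteq> Q' \<Longrightarrow> \<phi> \<in> cochains 1 Q'"
  unfolding cochains_1 tuples_1 by blast

lemma cochain_1_length: "\<phi> \<in> cochains 1 Q \<Longrightarrow> length xs \<noteq> 1 \<Longrightarrow> \<phi> xs = 0"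
  unfolding cochains_1 tuples_def by auto

lemma restr_single: "restr Q \<phi> [x] = (if x \<in> Q then \<phi> [x] else 0)"
  by (simp add: restr_def tuples_def)

lemma restr_cochain_1:
  assumes "\<phi> \<in> cochains 1 Q"
  shows "restr Q' \<phi> \<in> cochains 1 Q'"
  unfolding cochains_1
proof (intro allI impI)
  fix xs assume "xs \<notin> tuples 1 Q'"
  then show "restr Q' \<phi> xs = 0"
    using cochain_1_length[OF assms, of xs] by (cases "length xs = 1") (simp_all add: restr_def)
qed

lemma H1_zero: "0 \<in> H1 Q"
  by (simp add: H1_def cochains_zero hdiff_zero)

lemma H1_diff: "\<phi> \<in> H1 Q \<Longrightarrow> \<psi> \<in> H1 Q \<Longrightarrow> \<phi> - \<psi> \<in> H1 Q"
  unfolding H1_def using cochains_diff by (auto simp: hdiff_diff)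

lemma H1_restr: "\<phi> \<in> H1 Q \<Longrightarrow> Q' \<subseteq> Q \<Longrightarrow> restr Q' \<phi> \<in> H1 Q'"
  unfolding H1_iff restr_single using restr_cochain_1 by (auto simp: subset_iff)

lemma linear_fun_cochain_H1: "fun_cochain Q (\<lambda>r. pairing v (kvec r)) \<in> H1 Q"
  unfolding H1_iff
  by (intro conjI fun_cochain allI impI) (simp add: fun_cochain kvec_simps pairing_simps)

lemma lin_fun: "lin_fun q [r] = pairing q (kvec r)" "length xs \<noteq> 1 \<Longrightarrow> lin_fun q xs = 0"
  by (simp_all add: lin_fun_def)

lemma lin_fun_restr_H1: "restr Q (lin_fun q) \<in> H1 Q"
proof -
  have "restr Q (lin_fun q) = fun_cochain Q (\<lambda>r. pairing q (kvec r))"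
    by (intro ext) (auto simp: restr_def fun_cochain_def lin_fun_def tuples_def)
  then show ?thesis by (simp add: linear_fun_cochain_H1)
qed

lemma additive_on_lattice:
  fixes h :: "lattice \<Rightarrow> 'k::ring_1"
  assumes add: "\<And>x y. h (x + y) = h x + h y"
  shows "h m = h (axis 1 1) * of_int (m $ 1) + h (axis 2 1) * of_int (m $ 2) + h (axis 3 1) * of_int (m $ 3)"
proof -
  have zero: "h 0 = 0" using add[of 0 0] by simp
  have nat: "h (int i *s v) = h v * of_nat i" for i v
  proof (induction i)
    case (Suc i)
    have "int (Suc i) *s v = v + int i *s v" by (simp add: vec_eq_iff algebra_simps)
    then show ?case using Suc add by (simp add: algebra_simps)
  qed (simp add: zero)
  have mult: "h (c *s v) = h v * of_int c" for c v
  proof (cases c)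
    case (neg i)
    have "c + int (Suc i) = 0" using neg by simp
    then have "0 = h ((c + int (Suc i)) *s v)" by (simp only: zero vector_smult_lzero)
    also have "\<dots> = h (c *s v) + h v * of_nat (Suc i)" unfolding vector_sadd_rdistrib add nat ..
    finally have "h (c *s v) = - (h v * of_nat (Suc i))"
      by (simp only: eq_neg_iff_add_eq_0)
    moreover have "of_int c = - (of_nat (Suc i) :: 'k)" unfolding neg by simp
    ultimately show ?thesis by (simp only: mult_minus_right)
  qed (simp add: nat)
  have "m = m $ 1 *s axis 1 1 + m $ 2 *s axis 2 1 + m $ 3 *s axis 3 1"
    by (simp add: vec3_eq_iff axis_def)
  then have "h m = h (m $ 1 *s axis 1 1 + m $ 2 *s axis 2 1 + m $ 3 *s axis 3 1)" by simp
  then show ?thesis unfolding add mult .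
qed

context lattice_cone
begin

lemma Kset_iff: "j < n \<Longrightarrow> r \<in> Kset n a Rstar j \<longleftrightarrow> r \<in> L \<and> pairing (a j) r = 0"
  by (auto simp: Kset_def pairing_a_Rstar Lam_iff intro: antisym)

lemma K2_iff: "j < n \<Longrightarrow> r \<in> K2 n a j \<longleftrightarrow> r \<in> L \<and> pairing (a j) r \<le> 1"
  unfolding K2_def Kset_def pairing_simps by (auto simp: pairing_a_Rstar)

lemma shifted_iff: "r \<in> shifted L R \<longleftrightarrow> r - R \<in> L"
  unfolding shifted_def by (auto simp: image_iff algebra_simps intro: bexI[of _ "r - R"])

lemma minus_shifted_iff:
  "r \<in> L - shifted L R \<longleftrightarrow> r \<in> L \<and> (\<exists>j<n. pairing (a j) r < pairing (a j) R)"
  by (auto simp: shifted_iff Lam_iff pairing_simps not_le)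

lemma outside_shifted_Rstar: "r \<in> L - shifted L Rstar \<longleftrightarrow> (\<exists>j<n. r \<in> Kset n a Rstar j)"
  unfolding minus_shifted_iff by (auto simp: Kset_def)

lemma outside_shifted_2Rstar: "r \<in> L - shifted L (Rstar + Rstar) \<longleftrightarrow> (\<exists>j<n. r \<in> K2 n a j)"
  unfolding minus_shifted_iff by (auto simp: K2_def Kset_def)

text \<open>
  Values of \<open>a j\<close> on \<open>L\<close> are nonnegative, so \<open>K2\<close> contains the summands of its elements.
\<close>

lemma K2_summand:
  assumes "j < n" "x \<in> L" "y \<in> L" "x + y \<in> K2 n a j"
  shows "x \<in> K2 n a j"
proof -
  have "0 \<le> pairing (a j) y" using assms(1,3) Lam_iff by blast
  then show ?thesis using assms(1,2,4) by (auto simp: K2_iff pairing_simps)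
qed

text \<open>
  An additive function on the monoid of all \<open>r\<close> with \<open>\<langle>a\<^sub>j, r\<rangle> = 0\<close> extends to differences, that is, to the
  plane orthogonal to \<open>a\<^sub>j\<close>, because a relative interior vector \<open>f\<close> of the face can be added until a vector
  of the plane lies in the face. Any two elements on which \<open>a\<^sub>j\<close> takes the value one differ by a vector of this plane, so the
  value at \<open>R\<^sup>*\<close> determines the rest.
\<close>

lemma additive_on_K2_linear:
  fixes g :: "lattice \<Rightarrow> 'k::field_char_0"
  assumes j: "j < n"
    and add: "\<And>x y. x \<in> K2 n a j \<Longrightarrow> y \<in> K2 n a j \<Longrightarrow> x + y \<in> K2 n a j \<Longrightarrow> g (x + y) = g x + g y"
  shows "\<exists>b. \<forall>r\<in>K2 n a j. g r = pairing b (kvec r)"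
proof -
  let ?l = "pairing (a j)"
  obtain f where f: "\<And>i. i < n \<Longrightarrow> 0 \<le> pairing (a i) f" "\<And>i. i < n \<Longrightarrow> pairing (a i) f = 0 \<longleftrightarrow> i = j"
    using vertex_interior[OF j] by blast
  have f0: "?l f = 0" using f(2)[OF j] by simp
  have fL: "c *s f \<in> L" if "c \<ge> 0" for c
    using f(1) that by (simp add: Lam_iff pairing_simps)
  define d where "d m c \<longleftrightarrow> c \<ge> 0 \<and> m + c *s f \<in> L" for m c
  have reach: "\<exists>c. d m c" if "?l m = 0" for m
  proof -
    have "\<exists>c\<ge>0. \<forall>c'\<ge>c. m + c' *s f \<in> L"
      by (rule eventually_in_cone) (use f that in \<open>metis less_le order_refl\<close>)
    then show ?thesis unfolding d_def by blast
  qed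
  have add0: "g (x + y) = g x + g y" if "x \<in> L" "y \<in> L" "?l x = 0" "?l y \<le> 1" for x y
    by (rule add) (use that j in \<open>simp_all add: K2_iff pairing_simps Lam_add\<close>)
  have indep: "g (m + c *s f) - g (c *s f) = g (m + c' *s f) - g (c' *s f)"
    if "?l m = 0" "d m c" "d m c'" for m c c'
  proof -
    have "g (m + c *s f + c' *s f) = g (m + c *s f) + g (c' *s f)"
      "g (m + c' *s f + c *s f) = g (m + c' *s f) + g (c *s f)"
      by (rule add0; use that f0 fL in \<open>simp add: d_def pairing_simps\<close>)+
    moreover have "m + c *s f + c' *s f = m + c' *s f + c *s f" by simp
    ultimately have "g (m + c *s f) + g (c' *s f) = g (m + c' *s f) + g (c *s f)" by simp
    then show ?thesis by (simp add: algebra_simps)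
  qed
  define h0 where "h0 m = (let c = SOME c. d m c in g (m + c *s f) - g (c *s f))" for m
  have h0: "h0 m = g (m + c *s f) - g (c *s f)" if "?l m = 0" "d m c" for m c
    unfolding h0_def Let_def using someI[of "d m", OF that(2)] that by (intro indep) auto
  have h0_add: "h0 (x + y) = h0 x + h0 y" if xy: "?l x = 0" "?l y = 0" for x y
  proof -
    obtain c c' where c: "d x c" "d y c'" using reach[OF xy(1)] reach[OF xy(2)] by blast
    have eq: "x + y + (c + c') *s f = (x + c *s f) + (y + c' *s f)" "(c + c') *s f = c *s f + c' *s f"
      by (simp_all add: vector_sadd_rdistrib algebra_simps)
    have "d (x + y) (c + c')" using c Lam_add unfolding d_def eq(1) by simp
    then have "h0 (x + y) = g (x + y + (c + c') *s f) - g ((c + c') *s f)"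
      using xy by (intro h0) (simp_all add: pairing_simps)
    also have "g (x + y + (c + c') *s f) = g (x + c *s f) + g (y + c' *s f)"
      unfolding eq(1) using c xy f0 by (intro add0) (simp_all add: d_def pairing_simps)
    also have "g ((c + c') *s f) = g (c *s f) + g (c' *s f)"
      unfolding eq(2) using c f0 by (intro add0) (simp_all add: d_def pairing_simps fL)
    finally show ?thesis using h0[OF xy(1) c(1)] h0[OF xy(2) c(2)] by simp
  qed
  \<comment> \<open>the extension to all of the lattice along the projection with kernel spanned by \<open>R\<^sup>*\<close>\<close>
  define h where "h m = h0 (m - ?l m *s Rstar)" for m
  have l0: "?l (m - ?l m *s Rstar) = 0" for m
    using j by (simp add: pairing_simps pairing_a_Rstar)
  have h_add: "h (x + y) = h x + h y" for x y
  proof -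
    have eq: "x + y - ?l (x + y) *s Rstar = (x - ?l x *s Rstar) + (y - ?l y *s Rstar)"
      by (simp add: pairing_simps vector_sadd_rdistrib algebra_simps)
    show ?thesis unfolding h_def eq by (rule h0_add[OF l0 l0])
  qed
  have g: "g r = h r + of_int (?l r) * g Rstar" if r: "r \<in> K2 n a j" for r
  proof -
    have rL: "r \<in> L" and "?l r \<le> 1" "0 \<le> ?l r" using r j by (auto simp: K2_iff Lam_iff)
    then consider "?l r = 0" | "?l r = 1" by linarith
    then show ?thesis
    proof cases
      case 1
      have "g 0 = 0" using add0[of 0 0] Lam_zero by (simp add: pairing_simps)
      moreover have "d r 0" using rL by (simp add: d_def)
      ultimately show ?thesis using h0[OF 1, of 0] 1 by (simp add: h_def)
    next
      case 2
      have l: "?l (r - Rstar) = 0" using l0[of r] 2 by simp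
      obtain c where c: "d (r - Rstar) c" using reach[OF l] by blast
      have "g (c *s f + r) = g (c *s f) + g r"
        by (rule add0) (use c rL 2 f0 in \<open>simp_all add: d_def fL pairing_simps\<close>)
      moreover have "g ((r - Rstar + c *s f) + Rstar) = g (r - Rstar + c *s f) + g Rstar"
        by (rule add0) (use c l f0 j in \<open>simp_all add: d_def pairing_simps pairing_a_Rstar Rstar_mem\<close>)
      moreover have "(r - Rstar + c *s f) + Rstar = c *s f + r" by (simp add: algebra_simps)
      ultimately have "g (c *s f) + g r = g (r - Rstar + c *s f) + g Rstar" by (simp only:)
      also have "g (r - Rstar + c *s f) = g (c *s f) + h0 (r - Rstar)" using h0[OF l c] by simp
      finally have "g r = h0 (r - Rstar) + g Rstar" by (simp only: add.assoc add_left_cancel)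
      then show ?thesis using 2 by (simp add: h_def)
    qed
  qed
  define b where "b = (\<chi> i. h (axis i 1) + of_int (a j $ i) * g Rstar)"
  have "g r = pairing b (kvec r)" if "r \<in> K2 n a j" for r
    unfolding g[OF that] additive_on_lattice[of h, OF h_add, of r]
    by (simp add: b_def pairing_3 kvec_nth algebra_simps)
  then show ?thesis by blast
qed

lemma edge_pairing: "pairing (edge_vec n a j) r = pairing (a (nxt n j)) r - pairing (a j) r"
  by (simp add: edge_vec_def pairing_simps)

lemma lattice_length_edge:
  "j < n \<Longrightarrow> lattice_length (edge_vec n a j) = gcd (edge_vec n a j $ 1) (edge_vec n a j $ 2)"
  using edge_vec_nth[of j] by (simp add: lattice_length_def UNIV_3)

text \<open>
  On the overlap \<open>\<langle>d\<^sub>j, r\<rangle>\<close> is at most one in absolute value, and it is divisible by the lattice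
  length of \<open>d\<^sub>j\<close>.
\<close>

lemma edge_delta_vanishes:
  assumes j: "j < n" and r: "r \<in> K2 n a j" "r \<in> K2 n a (nxt n j)"
  shows "edge_delta n a j * pairing (kvec (edge_vec n a j)) (kvec r) = (0 :: 'k::field_char_0)"
proof (cases "lattice_length (edge_vec n a j) < 2")
  case False
  let ?d = "edge_vec n a j" and ?l = "lattice_length (edge_vec n a j)"
  have "?l dvd ?d $ i" for i unfolding lattice_length_def by (rule Gcd_dvd) simp
  then have dvd: "?l dvd pairing ?d r" unfolding pairing_3 by (intro dvd_add dvd_mult2)
  have bounds: "0 \<le> pairing (a i) r \<and> pairing (a i) r \<le> 1" if "i \<in> {j, nxt n j}" for i
    using that r j nxt_less by (auto simp: K2_iff Lam_iff)
  have "\<bar>pairing ?d r\<bar> \<le> 1"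
    using bounds[of j] bounds[of "nxt n j"] by (auto simp: edge_pairing)
  then have "pairing ?d r = 0"
    using dvd False zdvd_not_zless[of "\<bar>pairing ?d r\<bar>" ?l] dvd_imp_le_int[of "pairing ?d r" ?l] by auto
  then show ?thesis by (simp add: pairing_kvec)
qed (simp add: edge_delta_def)

text \<open>
  The overlap contains \<open>R\<^sup>*\<close> and the normal of the edge, which span the plane orthogonal to \<open>d\<^sub>j\<close>. If the lattice
  length is one, it also contains a vector on which \<open>d\<^sub>j\<close> takes the value one, obtained from
  a Bezout relation and moved into the cone by adding a multiple of the normal.
\<close>

lemma annihilator_of_edge:
  fixes q :: "'k::field_char_0^3"
  assumes j: "j < n" and q: "\<And>r. r \<in> K2 n a j \<Longrightarrow> r \<in> K2 n a (nxt n j) \<Longrightarrow> pairing q (kvec r) = 0"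
  shows "\<exists>c. q = c *s (edge_delta n a j *s kvec (edge_vec n a j))"
proof -
  let ?d = "edge_vec n a j" and ?p = "nxt n j"
  note p = nxt_less[of j]
  have d3: "?d $ 3 = 0" by (rule edge_vec_nth[OF j])
  have "Rstar \<in> K2 n a j" "Rstar \<in> K2 n a ?p"
    using j p by (simp_all add: K2_iff Rstar_mem pairing_a_Rstar)
  then have q3: "q $ 3 = 0" using q by (simp flip: pairing_kvec_Rstar)
  have n0: "pairing (a j) (normal j) = 0" "pairing (a ?p) (normal j) = 0"
    using normal_zero_iff[OF j j] normal_zero_iff[OF j p] by simp_all
  have "pairing q (kvec (normal j)) = 0"
    by (rule q) (use j p n0 in \<open>simp_all add: K2_iff normal_mem\<close>)
  then have "pairing q (kvec (edge_cross (a j) (a ?p))) = 0"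
    using normal_cases[of j] by (auto simp: kvec_simps pairing_simps)
  then have "q $ 2 * of_int (?d $ 1) = q $ 1 * of_int (?d $ 2)"
    by (simp add: pairing_3 kvec_nth edge_cross_nth q3 edge_vec_def algebra_simps)
  then obtain c where c: "q $ 1 = c * of_int (?d $ 1)" "q $ 2 = c * of_int (?d $ 2)"
  proof (cases "?d $ 1 = 0")
    case True
    then show ?thesis
      using edge_neq[OF j] that[of "q $ 2 / of_int (?d $ 2)"] \<open>q $ 2 * _ = _\<close> by auto
  next
    case False
    then show ?thesis
      using that[of "q $ 1 / of_int (?d $ 1)"] \<open>q $ 2 * _ = _\<close> by (auto simp: field_simps)
  qed
  have qc: "q = c *s kvec ?d" using c q3 d3 by (simp add: vec3_eq_iff kvec_nth)
  show ?thesis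
  proof (cases "lattice_length ?d < 2")
    case True
    have "gcd (?d $ 1) (?d $ 2) \<noteq> 0" using edge_neq[OF j] by simp
    then have "gcd (?d $ 1) (?d $ 2) > 0" by (simp add: less_le)
    then have "gcd (?d $ 1) (?d $ 2) = 1"
      using True lattice_length_edge[OF j] by linarith
    then obtain u v where uv: "u * ?d $ 1 + v * ?d $ 2 = 1" using bezout_int by metis
    define x :: lattice where "x = vector [u, v, - (a j $ 1 * u + a j $ 2 * v)]"
    have x: "pairing (a j) x = 0" using a3[OF j] by (simp add: x_def pairing_3)
    have dx: "pairing ?d x = 1" using d3 uv by (simp add: x_def pairing_3 algebra_simps)
    then have xp: "pairing (a ?p) x = 1" using x by (simp add: edge_pairing)
    have "\<exists>c\<ge>0. \<forall>c'\<ge>c. x + c' *s normal j \<in> L"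
      by (rule eventually_in_cone) (use normal_zero_iff[OF j] normal_nonneg[OF j] x xp in \<open>force simp: less_le\<close>)
    then obtain c' where "x + c' *s normal j \<in> L" by blast
    then have "pairing q (kvec (x + c' *s normal j)) = 0"
      using n0 x xp j p by (intro q) (simp_all add: K2_iff pairing_simps)
    then have "c * of_int (pairing ?d (x + c' *s normal j)) = 0"
      unfolding qc by (simp add: pairing_simps(9) pairing_kvec)
    moreover have "pairing ?d (x + c' *s normal j) = 1"
      using dx n0 by (simp add: pairing_simps(1,4)) (simp add: edge_pairing)
    ultimately have "c = 0" by simp
    then show ?thesis using qc by (intro exI[of _ 0]) simp
  next
    case False
    then show ?thesis using qc by (auto simp: edge_delta_def)
  qed
qed

end

section \<open>The identification of T1\<close>

lemma equiv_mod_ones: "equiv (Vsp n a :: (nat \<Rightarrow> 'k::field_char_0) set) (mod_ones n a)"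
proof -
  let ?B = "{u :: nat \<Rightarrow> 'k. \<exists>c. \<forall>j<n. u j = c}"
  have "equiv (Vsp n a) {(t, t'). t \<in> Vsp n a \<and> t' \<in> Vsp n a \<and> t - t' \<in> ?B}"
  proof (rule equiv_diff_subgroup)
    fix u v assume "u \<in> ?B" "v \<in> ?B"
    then obtain c d where "\<forall>j<n. u j = c" "\<forall>j<n. v j = d" by blast
    then have "\<forall>j<n. (u - v) j = c - d" by simp
    then show "u - v \<in> ?B" by blast
  qed simp
  then show ?thesis by (simp add: mod_ones_def)
qed

context lattice_cone
begin

text \<open>
  Partial sums of \<open>t\<^sub>j d\<^sub>j\<close>; the defining condition of \<open>V\<close> closes the cycle.
\<close>

lemma T1_choice_exists:
  fixes t :: "nat \<Rightarrow> 'k::field_char_0"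
  assumes t: "t \<in> Vsp n a"
  obtains b where "T1_choice n a t b"
proof -
  define s where "s i = t i *s kvec (edge_vec n a i)" for i
  define b where "b j = (\<Sum>i<j. s i)" for j
  have total: "(\<Sum>i<n. s i) = 0" using t by (simp add: Vsp_def s_def)
  have "b (nxt n j) - b j = s j" if j: "j < n" for j
  proof (cases "Suc j = n")
    case True
    then have "b j + s j = 0" using total by (auto simp: b_def)
    moreover have "b (nxt n j) = 0" using True by (simp add: nxt_def b_def)
    ultimately show ?thesis by (simp add: add_eq_0_iff)
  next
    case False
    then show ?thesis using j by (simp add: nxt_def b_def)
  qed
  moreover have "s i $ 3 = 0" if "i < n" for i
    using edge_vec_nth[OF that] by (simp add: s_def kvec_nth)
  then have "b j $ 3 = 0" if "j < n" for j
    unfolding b_def sum_component using that by simp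
  ultimately have "T1_choice n a t b"
    unfolding T1_choice_def pairing_kvec_Rstar s_def by blast
  then show ?thesis by (rule that)
qed

text \<open>
  Two different vertices are adjacent, and then \<open>d\<^sub>j\<close> vanishes on the common part of their faces,
  or this common part is the origin.
\<close>

lemma T1_choice_agree:
  assumes b: "T1_choice n a t b" and ij: "i < n" "j < n"
    and r: "r \<in> Kset n a Rstar i" "r \<in> Kset n a Rstar j"
  shows "pairing (b i) (kvec r) = pairing (b j) (kvec r :: 'k::field_char_0^3)"
proof -
  have r0: "r \<in> L" "pairing (a i) r = 0" "pairing (a j) r = 0"
    using r ij by (simp_all add: Kset_iff)
  have adj: "pairing (b (nxt n k)) (kvec r) = pairing (b k) (kvec r)"
    if "k < n" "pairing (a k) r = 0" "pairing (a (nxt n k)) r = 0" for k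
  proof -
    have "pairing (b (nxt n k) - b k) (kvec r) = t k * of_int (pairing (edge_vec n a k) r)"
      using b that(1) by (simp add: T1_choice_def pairing_simps(9) pairing_kvec)
    then show ?thesis using that by (simp add: edge_pairing pairing_simps)
  qed
  consider "i = j" | "j = nxt n i" | "i = nxt n j" | "r = 0"
    using vanish_at_nonadjacent_vertices[OF r0(1) ij] r0 by blast
  then show ?thesis
    by cases (use adj[of i] adj[of j] ij r0 in \<open>simp_all add: kvec_simps pairing_simps\<close>)
qed

text \<open>
  The values off the faces are arbitrary, so this describes all functions that differ from the glued function
  \<open>\<xi>\<close> by a relative cochain.
\<close>

definition compatible :: "(nat \<Rightarrow> 'k::field_char_0^3) \<Rightarrow> (lattice list \<Rightarrow> 'k) \<Rightarrow> bool" where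
  "compatible b \<phi> \<longleftrightarrow> \<phi> \<in> cochains 1 L \<and> (\<forall>j<n. \<forall>r\<in>Kset n a Rstar j. \<phi> [r] = pairing (b j) (kvec r))"

lemma T1_glued_compatible: "T1_glued n a b \<xi> \<Longrightarrow> compatible b \<xi>"
  unfolding T1_glued_def compatible_def H1_iff cochains_1 tuples_1 by blast

lemma T1_glued_exists:
  fixes b :: "nat \<Rightarrow> 'k::field_char_0^3"
  assumes b: "T1_choice n a t b"
  obtains \<xi> where "T1_glued n a b \<xi>"
proof -
  let ?U = "L - shifted L Rstar"
  define v where "v r = pairing (b (SOME j. j < n \<and> r \<in> Kset n a Rstar j)) (kvec r)" for r
  have v: "v r = pairing (b j) (kvec r)" if "j < n" "r \<in> Kset n a Rstar j" for r j
    unfolding v_def using someI[of "\<lambda>j. j < n \<and> r \<in> Kset n a Rstar j" j] that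
    by (intro T1_choice_agree[OF b]) auto
  have add: "v (x + y) = v x + v y" if xy: "x \<in> ?U" "y \<in> ?U" "x + y \<in> ?U" for x y
  proof -
    obtain j where j: "j < n" "x + y \<in> Kset n a Rstar j"
      using xy(3) unfolding outside_shifted_Rstar by blast
    have "0 \<le> pairing (a j) x" "0 \<le> pairing (a j) y" using xy j(1) Lam_iff by blast+
    then have "x \<in> Kset n a Rstar j" "y \<in> Kset n a Rstar j"
      using j xy by (auto simp: Kset_iff pairing_simps)
    then show ?thesis using v j by (simp add: kvec_simps pairing_simps)
  qed
  have "T1_glued n a b (fun_cochain ?U v)"
    unfolding T1_glued_def H1_iff
  proof (intro conjI allI impI ballI)
    fix j r assume "j < n" "r \<in> Kset n a Rstar j"
    moreover from this have "r \<in> ?U" unfolding outside_shifted_Rstar by blast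
    ultimately show "fun_cochain ?U v [r] = pairing (b j) (kvec r)" by (simp only: fun_cochain v)
  next
    fix x y assume "x \<in> ?U" "y \<in> ?U" "x + y \<in> ?U"
    then show "fun_cochain ?U v [x + y] = fun_cochain ?U v [x] + fun_cochain ?U v [y]"
      by (simp only: fun_cochain add)
  qed (rule fun_cochain)
  then show ?thesis by (rule that)
qed

lemma compatible_rel_cocycle:
  assumes "compatible b \<phi>"
  shows "hdiff L \<phi> \<in> rel_cocycles 2 L Rstar"
proof -
  have \<phi>: "\<phi> \<in> cochains 1 L" and val: "\<And>j r. j < n \<Longrightarrow> r \<in> Kset n a Rstar j \<Longrightarrow> \<phi> [r] = pairing (b j) (kvec r)"
    using assms by (auto simp: compatible_def)
  have "hdiff L \<phi> [x, y] = 0" if xy: "x \<in> L" "y \<in> L" "x + y \<in> L - shifted L Rstar" for x y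
  proof -
    obtain j where j: "j < n" "x + y \<in> Kset n a Rstar j"
      using xy(3) unfolding outside_shifted_Rstar by blast
    have "0 \<le> pairing (a j) x" "0 \<le> pairing (a j) y" using xy j(1) Lam_iff by blast+
    then have "x \<in> Kset n a Rstar j" "y \<in> Kset n a Rstar j"
      using j xy by (auto simp: Kset_iff pairing_simps)
    then show ?thesis using val j by (simp add: hdiff_2 kvec_simps pairing_simps)
  qed
  then show ?thesis
    using hdiff_cochains_2[OF \<phi>] hdiff_hdiff_1[OF \<phi> Lam_add]
    unfolding rel_cocycles_def rel_cochains_def by (auto simp: tuples_2)
qed

lemma rel_cochains_1:
  "h \<in> rel_cochains 1 L Rstar \<longleftrightarrow> h \<in> cochains 1 L \<and> (\<forall>j<n. \<forall>r\<in>Kset n a Rstar j. h [r] = 0)"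
proof -
  have "(\<forall>xs\<in>tuples 1 Q. h xs = 0) \<longleftrightarrow> (\<forall>r\<in>Q. h [r] = 0)" for Q
    unfolding Ball_def tuples_1 by auto
  then show ?thesis
    unfolding rel_cochains_def mem_Collect_eq using outside_shifted_Rstar by metis
qed

lemma cohomologous_compatible:
  assumes \<xi>: "compatible b \<xi>"
  shows "cohomologous 2 L Rstar `` {hdiff L \<xi>} = hdiff L ` {\<phi>. compatible b \<phi>}"
proof (intro equalityI subsetI)
  fix f assume "f \<in> cohomologous 2 L Rstar `` {hdiff L \<xi>}"
  then obtain h where h: "h \<in> rel_cochains 1 L Rstar" "hdiff L \<xi> - f = hdiff L h"
    unfolding cohomologous_def by auto
  have "f = hdiff L (\<xi> - h)" using h(2) by (simp add: hdiff_diff algebra_simps flip: h(2))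
  moreover have "compatible b (\<xi> - h)"
    using \<xi> h(1) cochains_diff unfolding compatible_def rel_cochains_1 by fastforce
  ultimately show "f \<in> hdiff L ` {\<phi>. compatible b \<phi>}" by blast
next
  fix f assume "f \<in> hdiff L ` {\<phi>. compatible b \<phi>}"
  then obtain \<phi> where \<phi>: "compatible b \<phi>" "f = hdiff L \<phi>" by blast
  have "\<xi> - \<phi> \<in> rel_cochains 1 L Rstar"
    using \<xi> \<phi>(1) cochains_diff unfolding compatible_def rel_cochains_1 by fastforce
  then have "hdiff L \<xi> - hdiff L \<phi> \<in> hdiff L ` rel_cochains (2 - 1) L Rstar"
    by (simp flip: hdiff_diff)
  then show "f \<in> cohomologous 2 L Rstar `` {hdiff L \<xi>}"
    using compatible_rel_cocycle[OF \<xi>] compatible_rel_cocycle[OF \<phi>(1)] \<phi>(2)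
    unfolding cohomologous_def by blast
qed

text \<open>
  By induction along the cycle \<open>b\<^sub>j\<close> and \<open>b'\<^sub>j\<close> differ by \<open>v + c a\<^sub>j\<close> with a constant vector \<open>v\<close>.
  Subtracting the linear function \<open>v\<close> does not change the coboundary, and \<open>a\<^sub>j\<close> vanishes on its face.
\<close>

lemma compatible_change_of_choice:
  fixes t :: "nat \<Rightarrow> 'k::field_char_0"
  assumes b: "T1_choice n a t b" "T1_choice n a t' b'" and c: "\<And>j. j < n \<Longrightarrow> t j - t' j = c"
  shows "hdiff L ` {\<phi>. compatible b \<phi>} \<subseteq> hdiff L ` {\<phi>. compatible b' \<phi>}"
proof
  fix f assume "f \<in> hdiff L ` {\<phi>. compatible b \<phi>}"
  then obtain \<phi> where \<phi>: "compatible b \<phi>" "f = hdiff L \<phi>" by blast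
  define v where "v = b 0 - b' 0 - c *s kvec (a 0)"
  have bj: "b j = b' j + v + c *s kvec (a j)" if "j < n" for j
    using that
  proof (induction j)
    case (Suc j)
    then have "j < n" "nxt n j = Suc j" by (simp_all add: nxt_def)
    then have "b (Suc j) - b j = t j *s kvec (edge_vec n a j)"
      "b' (Suc j) - b' j = t' j *s kvec (edge_vec n a j)"
      "kvec (edge_vec n a j) = kvec (a (Suc j)) - (kvec (a j) :: 'k^3)"
      using b unfolding T1_choice_def edge_vec_def by (auto simp: kvec_simps)
    then have e: "b (Suc j) = b j + t j *s (kvec (a (Suc j)) - kvec (a j))"
      "b' (Suc j) = b' j + t' j *s (kvec (a (Suc j)) - kvec (a j))"
      by (simp_all add: algebra_simps)
    have tc: "t j = t' j + c" using c[OF \<open>j < n\<close>] by (simp add: algebra_simps)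
    show ?case
      unfolding e tc Suc.IH[OF \<open>j < n\<close>] by (simp add: vec_eq_iff algebra_simps)
  qed (simp add: v_def)
  let ?l = "fun_cochain L (\<lambda>r. pairing v (kvec r))"
  have "(\<phi> - ?l) [r] = pairing (b' j) (kvec r)" if "j < n" "r \<in> Kset n a Rstar j" for j r
  proof -
    have "r \<in> L" "pairing (a j) r = 0" using that by (simp_all add: Kset_iff)
    moreover have "\<phi> [r] = pairing (b j) (kvec r)" using \<phi>(1) that by (simp add: compatible_def)
    ultimately show ?thesis
      using bj[OF that(1)] by (simp add: fun_cochain pairing_simps pairing_kvec)
  qed
  then have "compatible b' (\<phi> - ?l)"
    using \<phi>(1) cochains_diff fun_cochain unfolding compatible_def by blast
  moreover have "hdiff L ?l = 0" using linear_fun_cochain_H1 unfolding H1_def by blast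
  then have "f = hdiff L (\<phi> - ?l)" using \<phi>(2) by (simp add: hdiff_diff)
  ultimately show "f \<in> hdiff L ` {\<phi>. compatible b' \<phi>}" by blast
qed

lemma T1_ident_eq:
  assumes \<tau>: "\<tau> \<in> Vsp n a // mod_ones n a" and t: "t \<in> \<tau>" and b: "T1_choice n a t b"
  shows "T1_ident n a \<tau> = hdiff L ` {\<phi>. compatible b \<phi>}"
proof -
  have rel: "(u, v) \<in> mod_ones n a" if "u \<in> \<tau>" "v \<in> \<tau>" for u v
    using quotient_eq_iff[OF equiv_mod_ones \<tau> \<tau> that] by simp
  have "hdiff L ` {\<phi>. compatible b' \<phi>} = hdiff L ` {\<phi>. compatible b \<phi>}"
    if "t' \<in> \<tau>" "T1_choice n a t' b'" for t' b'
    using compatible_change_of_choice[OF b that(2)] compatible_change_of_choice[OF that(2) b]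
      rel[OF t that(1)] rel[OF that(1) t] unfolding mod_ones_def by blast
  then have "cohomologous 2 L Rstar `` {hdiff L \<xi>} = hdiff L ` {\<phi>. compatible b \<phi>}"
    if "t' \<in> \<tau>" "T1_choice n a t' b'" "T1_glued n a b' \<xi>" for t' b' \<xi>
    using that cohomologous_compatible[OF T1_glued_compatible[OF that(3)]] by blast
  moreover obtain \<xi> where "T1_glued n a b \<xi>" using T1_glued_exists[OF b] .
  ultimately show ?thesis using t b unfolding T1_ident_def by blast
qed

lemma T1_ident_in_T_mod:
  assumes "\<tau> \<in> Vsp n a // mod_ones n a"
  shows "T1_ident n a \<tau> \<in> T_mod 1 L Rstar"
proof -
  obtain t where t: "t \<in> \<tau>" "t \<in> Vsp n a"
    using assms equiv_mod_ones by (metis in_quotient_imp_non_empty in_quotient_imp_subset ex_in_conv subsetD)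
  obtain b where b: "T1_choice n a t b" using T1_choice_exists[OF t(2)] .
  obtain \<xi> where "T1_glued n a b \<xi>" using T1_glued_exists[OF b] .
  then have \<xi>: "compatible b \<xi>" by (rule T1_glued_compatible)
  have "T1_ident n a \<tau> = cohomologous 2 L Rstar `` {hdiff L \<xi>}"
    unfolding T1_ident_eq[OF assms t(1) b] cohomologous_compatible[OF \<xi>] ..
  then show ?thesis
    unfolding T_mod_def using quotientI[OF compatible_rel_cocycle[OF \<xi>]] by (simp add: numeral_2_eq_2)
qed

section \<open>The bracket of two coboundaries\<close>

text \<open>
  By the Leibniz rule the first two products have the coboundary
  \<open>d\<phi>(x, y) \<psi>(z) + d\<psi>(x, y) \<phi>(z) - \<phi>(x) d\<psi>(y, z) - \<psi>(x) d\<phi>(y, z)\<close>; the shifted terms turn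
  these values of \<open>\<phi>\<close> and \<open>\<psi>\<close> into the coboundaries that occur in the bracket.
\<close>

definition bracket_primitive ::
    "(lattice list \<Rightarrow> 'k::field_char_0) \<Rightarrow> (lattice list \<Rightarrow> 'k) \<Rightarrow> lattice list \<Rightarrow> 'k" where
  "bracket_primitive \<phi> \<psi> = (\<lambda>xs. if xs \<in> tuples 2 L then
     (let x = xs ! 0; y = xs ! 1 in
        \<phi> [x] * \<psi> [y] + \<psi> [x] * \<phi> [y]
      - \<phi> [- Rstar + x + y] * hdiff L \<psi> [x, y] - \<psi> [- Rstar + x + y] * hdiff L \<phi> [x, y])
   else 0)"

lemma bracket_primitive_pair:
  "x \<in> L \<Longrightarrow> y \<in> L \<Longrightarrow> bracket_primitive \<phi> \<psi> [x, y] = \<phi> [x] * \<psi> [y] + \<psi> [x] * \<phi> [y]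
     - \<phi> [- Rstar + x + y] * (\<psi> [x] + \<psi> [y] - \<psi> [x + y])
     - \<psi> [- Rstar + x + y] * (\<phi> [x] + \<phi> [y] - \<phi> [x + y])"
  unfolding bracket_primitive_def tuples_2 hdiff_2 by (simp add: Lam_add)

lemma bracket_primitive_cochain: "bracket_primitive \<phi> \<psi> \<in> cochains 2 L"
proof -
  have "bracket_primitive \<phi> \<psi> [x, y] = bracket_primitive \<phi> \<psi> [y, x]" for x y
  proof (cases "[x, y] \<in> tuples 2 L")
    case True
    then have "x \<in> L" "y \<in> L" by (auto simp: tuples_2)
    moreover have "y + x = x + y" "- Rstar + y + x = - Rstar + x + y" by (simp_all add: ac_simps)
    ultimately show ?thesis by (simp only: bracket_primitive_pair) (simp add: algebra_simps)
  next
    case False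
    then have "[y, x] \<notin> tuples 2 L" by (auto simp: tuples_2 add.commute)
    then show ?thesis using False by (simp add: bracket_primitive_def)
  qed
  then show ?thesis by (simp add: cochains_2 bracket_primitive_def)
qed

text \<open>
  A sum that does not lie above \<open>R\<^sup>*\<close> is on some face, and so are its summands.
\<close>

lemma compatible_coboundary_vanishes:
  assumes "compatible b \<phi>" "x \<in> L" "y \<in> L" "- Rstar + x + y \<notin> L"
  shows "\<phi> [x + y] = \<phi> [x] + \<phi> [y]"
proof -
  have "x + y \<in> L - shifted L Rstar"
    using assms Lam_add by (simp add: shifted_iff algebra_simps)
  then obtain j where j: "j < n" "x + y \<in> Kset n a Rstar j"
    unfolding outside_shifted_Rstar by blast
  have "0 \<le> pairing (a j) x" "0 \<le> pairing (a j) y" using assms j(1) Lam_iff by blast+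
  then have "x \<in> Kset n a Rstar j" "y \<in> Kset n a Rstar j"
    using j assms by (auto simp: Kset_iff pairing_simps)
  then show ?thesis using assms(1) j by (simp add: compatible_def kvec_simps pairing_simps)
qed

text \<open>
  If a shifted argument leaves \<open>\<Lambda>\<close>, the factor by which it is multiplied vanishes. So the coboundaries
  in the bracket may be expanded as if all arguments were in \<open>\<Lambda>\<close>, and the claim becomes a polynomial identity.
\<close>

lemma bracket_eq_coboundary:
  assumes \<phi>: "compatible b \<phi>" and \<psi>: "compatible b' \<psi>"
  shows "bracket L Rstar Rstar (hdiff L \<phi>) (hdiff L \<psi>) = hdiff L (bracket_primitive \<phi> \<psi>)"
proof
  fix xs
  show "bracket L Rstar Rstar (hdiff L \<phi>) (hdiff L \<psi>) xs = hdiff L (bracket_primitive \<phi> \<psi>) xs"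
  proof (cases "xs \<in> tuples 3 L")
    case True
    then obtain x y z where xs: "xs = [x, y, z]" and L: "x \<in> L" "y \<in> L" "z \<in> L"
      by (auto simp: tuples_3)
    have right: "hdiff L \<phi> [- Rstar + x + y, z] * hdiff L \<psi> [x, y]
        = (\<phi> [- Rstar + x + y] + \<phi> [z] - \<phi> [- Rstar + x + y + z]) * hdiff L \<psi> [x, y]"
      if "compatible b \<phi>" "compatible b' \<psi>" "x \<in> L" "y \<in> L" "z \<in> L" for b b' \<phi> \<psi> x y z
      using compatible_coboundary_vanishes[OF that(2,3,4)] that Lam_add by (auto simp: hdiff_2)
    have left: "hdiff L \<phi> [x, - Rstar + y + z] * hdiff L \<psi> [y, z]
        = (\<phi> [x] + \<phi> [- Rstar + y + z] - \<phi> [- Rstar + x + y + z]) * hdiff L \<psi> [y, z]"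
      if "compatible b \<phi>" "compatible b' \<psi>" "x \<in> L" "y \<in> L" "z \<in> L" for b b' \<phi> \<psi> x y z
    proof -
      have "x + (- Rstar + y + z) = - Rstar + x + y + z" by (simp add: ac_simps)
      note eq = this
      show ?thesis
      proof (cases "- Rstar + y + z \<in> L")
        case True
        then have "hdiff L \<phi> [x, - Rstar + y + z] = \<phi> [x] + \<phi> [- Rstar + y + z] - \<phi> [- Rstar + x + y + z]"
          unfolding hdiff_2 eq[symmetric] using that(3) Lam_add[OF that(3) True]
          by (simp only: if_True simp_thms)
        then show ?thesis by (simp only:)
      next
        case False
        then have "hdiff L \<psi> [y, z] = 0"
          using compatible_coboundary_vanishes[OF that(2,4,5)] by (simp add: hdiff_2)
        then show ?thesis by simp
      qed
    qed
    have br: "bracket L Rstar Rstar (hdiff L \<phi>) (hdiff L \<psi>) xs =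
        hdiff L \<phi> [- Rstar + x + y, z] * hdiff L \<psi> [x, y] - hdiff L \<phi> [x, - Rstar + y + z] * hdiff L \<psi> [y, z]
      + hdiff L \<psi> [- Rstar + x + y, z] * hdiff L \<phi> [x, y] - hdiff L \<psi> [x, - Rstar + y + z] * hdiff L \<phi> [y, z]"
      using True unfolding bracket_def xs by (simp add: numeral_2_eq_2)
    have pr: "hdiff L (bracket_primitive \<phi> \<psi>) xs = bracket_primitive \<phi> \<psi> [y, z]
        - bracket_primitive \<phi> \<psi> [x + y, z] + bracket_primitive \<phi> \<psi> [x, y + z] - bracket_primitive \<phi> \<psi> [x, y]"
      unfolding xs hdiff_3 using L Lam_add by simp
    have eqs: "- Rstar + (x + y) + z = - Rstar + x + y + z" "- Rstar + x + (y + z) = - Rstar + x + y + z"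
      "x + (y + z) = x + y + z" by (simp_all add: ac_simps)
    have pairs: "hdiff L f [x, y] = f [x] + f [y] - f [x + y]" "hdiff L f [y, z] = f [y] + f [z] - f [y + z]"
      for f :: "lattice list \<Rightarrow> 'a" using L Lam_add by (simp_all add: hdiff_2)
    note mem = L Lam_add[OF L(1,2)] Lam_add[OF L(2,3)]
    show ?thesis
      unfolding br pr right[OF \<phi> \<psi> L] right[OF \<psi> \<phi> L] left[OF \<phi> \<psi> L] left[OF \<psi> \<phi> L]
      unfolding pairs bracket_primitive_pair[OF mem(2,3)] bracket_primitive_pair[OF mem(4,3)]
        bracket_primitive_pair[OF mem(1,5)] bracket_primitive_pair[OF mem(1,2)] eqs
      by (simp only: algebra_simps)
  next
    case False
    moreover have "hdiff L (bracket_primitive \<phi> \<psi>) xs = 0"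
      using False hdiff_cochains_3[OF bracket_primitive_cochain[of \<phi> \<psi>] Lam_add] by (simp add: cochains_def)
    ultimately show ?thesis by (simp add: bracket_def)
  qed
qed

definition local_primitive ::
    "(nat \<Rightarrow> 'k::field_char_0^3) \<Rightarrow> (nat \<Rightarrow> 'k^3) \<Rightarrow> (lattice list \<Rightarrow> 'k) \<Rightarrow> (lattice list \<Rightarrow> 'k) \<Rightarrow> nat \<Rightarrow> lattice \<Rightarrow> 'k"
  where "local_primitive b b' \<phi> \<psi> j r = pairing (b j) (kvec r) * pairing (b' j) (kvec r)
    - pairing (b j) (kvec r) * \<psi> [r] - pairing (b' j) (kvec r) * \<phi> [r]"

text \<open>
  One of \<open>x\<close> and \<open>y\<close> lies on the face of \<open>a\<^sub>j\<close>, since the values of \<open>a\<^sub>j\<close> add up to at most one. If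
  \<open>x + y - R\<^sup>*\<close> is in \<open>\<Lambda>\<close>, it lies on this face as well, where \<open>\<phi>\<close> and \<open>\<psi>\<close> are the linear functions that
  take the same value at \<open>x + y\<close>.
\<close>

lemma bracket_primitive_on_K2:
  assumes bb: "T1_choice n a t b" "T1_choice n a s b'"
    and \<phi>: "compatible b \<phi>" and \<psi>: "compatible b' \<psi>" and j: "j < n"
    and K: "x \<in> K2 n a j" "y \<in> K2 n a j" "x + y \<in> K2 n a j"
  shows "bracket_primitive \<phi> \<psi> [x, y] = local_primitive b b' \<phi> \<psi> j x + local_primitive b b' \<phi> \<psi> j y
    - local_primitive b b' \<phi> \<psi> j (x + y)"
proof -
  have L: "x \<in> L" "y \<in> L" "x + y \<in> L" using K j by (simp_all add: K2_iff)
  define B B' where "B r = pairing (b j) (kvec r)" and "B' r = pairing (b' j) (kvec r)" for r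
  have add: "B (x + y) = B x + B y" "B' (x + y) = B' x + B' y"
    by (simp_all add: B_def B'_def kvec_simps pairing_simps)
  have on_K: "\<phi> [r] = B r" "\<psi> [r] = B' r" if "r \<in> L" "pairing (a j) r = 0" for r
    using \<phi> \<psi> j that unfolding B_def B'_def compatible_def by (simp_all add: Kset_iff)
  have "B Rstar = 0" "B' Rstar = 0" using bb j by (simp_all add: T1_choice_def B_def B'_def)
  then have B_shift: "B (- Rstar + x + y) = B x + B y" "B' (- Rstar + x + y) = B' x + B' y"
    by (simp_all add: B_def B'_def kvec_simps pairing_simps)
  have bounds: "0 \<le> pairing (a j) x" "0 \<le> pairing (a j) y" "pairing (a j) x + pairing (a j) y \<le> 1"
    using K L j by (auto simp: K2_iff Lam_iff pairing_simps)
  have shift: "\<phi> [- Rstar + x + y] * (\<psi> [x] + \<psi> [y] - \<psi> [x + y]) = (B x + B y) * (\<psi> [x] + \<psi> [y] - \<psi> [x + y])"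
    "\<psi> [- Rstar + x + y] * (\<phi> [x] + \<phi> [y] - \<phi> [x + y]) = (B' x + B' y) * (\<phi> [x] + \<phi> [y] - \<phi> [x + y])"
  proof -
    have "\<phi> [- Rstar + x + y] = B x + B y \<and> \<psi> [- Rstar + x + y] = B' x + B' y" if z: "- Rstar + x + y \<in> L"
    proof -
      have "0 \<le> pairing (a j) (- Rstar + x + y)" using z j Lam_iff by blast
      then have "pairing (a j) (- Rstar + x + y) = 0"
        using bounds j by (simp add: pairing_simps pairing_a_Rstar)
      then show ?thesis using on_K[OF z] B_shift by simp
    qed
    then show "\<phi> [- Rstar + x + y] * (\<psi> [x] + \<psi> [y] - \<psi> [x + y]) = (B x + B y) * (\<psi> [x] + \<psi> [y] - \<psi> [x + y])"
      "\<psi> [- Rstar + x + y] * (\<phi> [x] + \<phi> [y] - \<phi> [x + y]) = (B' x + B' y) * (\<phi> [x] + \<phi> [y] - \<phi> [x + y])"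
      using compatible_coboundary_vanishes[OF \<phi> L(1,2)] compatible_coboundary_vanishes[OF \<psi> L(1,2)]
      by (cases "- Rstar + x + y \<in> L"; simp)+
  qed
  consider "pairing (a j) x = 0" | "pairing (a j) y = 0" using bounds by linarith
  \<comment> \<open>the difference of both sides of the claim\<close>
  then have zero: "(\<phi> [x] - B x) * (\<psi> [y] - B' y) + (\<psi> [x] - B' x) * (\<phi> [y] - B y) = 0"
    using on_K L by cases simp_all
  show ?thesis
    unfolding bracket_primitive_pair[OF L(1,2)] local_primitive_def shift
    unfolding B_def[symmetric] B'_def[symmetric] add using zero by algebra
qed

text \<open>
  If \<open>d\<^sub>j\<close> does not vanish at \<open>r\<close>, then \<open>r\<close> lies on the face of exactly one of the two vertices, and \<open>\<phi>\<close> and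
  \<open>\<psi>\<close> can be replaced by the linear functions of that vertex.
\<close>

lemma local_primitive_edge:
  assumes bb: "T1_choice n a t b" "T1_choice n a s b'"
    and \<phi>: "compatible b \<phi>" and \<psi>: "compatible b' \<psi>" and j: "j < n"
    and r: "r \<in> K2 n a j" "r \<in> K2 n a (nxt n j)"
  shows "local_primitive b b' \<phi> \<psi> (nxt n j) r - local_primitive b b' \<phi> \<psi> j r
    = s j * t j * pairing (kvec (edge_vec n a j)) (kvec r)"
proof -
  let ?p = "nxt n j"
  note p = nxt_less[of j]
  define d where "d = pairing (edge_vec n a j) r"
  define B B' where "B k = pairing (b k) (kvec r)" and "B' k = pairing (b' k) (kvec r)" for k
  have "b ?p = b j + t j *s kvec (edge_vec n a j)" "b' ?p = b' j + s j *s kvec (edge_vec n a j)"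
    using bb j by (auto simp: T1_choice_def algebra_simps)
  then have step: "B ?p = B j + t j * of_int d" "B' ?p = B' j + s j * of_int d"
    by (simp_all add: B_def B'_def d_def pairing_simps pairing_kvec)
  have L: "r \<in> L" using r j by (simp add: K2_iff)
  have on_K: "\<phi> [r] = B k" "\<psi> [r] = B' k" if "k < n" "pairing (a k) r = 0" for k
    using \<phi> \<psi> L that unfolding B_def B'_def compatible_def by (simp_all add: Kset_iff)
  have bounds: "0 \<le> pairing (a k) r" "pairing (a k) r \<le> 1" if "k \<in> {j, ?p}" for k
    using r L j p that by (auto simp: K2_iff Lam_iff)
  have d: "d = pairing (a ?p) r - pairing (a j) r" by (simp add: d_def edge_pairing)
  consider "d = 0" | "d = 1" "pairing (a j) r = 0" | "d = - 1" "pairing (a ?p) r = 0"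
    using d bounds[of j] bounds[of ?p] by fastforce
  then have "B ?p * B' ?p - B ?p * \<psi> [r] - B' ?p * \<phi> [r] - (B j * B' j - B j * \<psi> [r] - B' j * \<phi> [r])
      = s j * t j * of_int d"
  proof cases
    case 1
    then show ?thesis using step by simp
  next
    case 2
    then show ?thesis using step on_K[OF j] by (simp add: algebra_simps)
  next
    case 3
    moreover have "B j = B ?p + t j" "B' j = B' ?p + s j" using 3 step by (simp_all add: algebra_simps)
    ultimately show ?thesis using on_K[OF p] by (simp add: algebra_simps)
  qed
  then show ?thesis
    unfolding local_primitive_def B_def[symmetric] B'_def[symmetric] pairing_kvec d_def .
qed

lemma bracket_primitive_rel_cocycle:
  assumes "T1_choice n a t b" "T1_choice n a s b'" "compatible b \<phi>" "compatible b' \<psi>"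
  shows "hdiff L (bracket_primitive \<phi> \<psi>) \<in> rel_cocycles 3 L (Rstar + Rstar)"
proof -
  note C = bracket_primitive_cochain[of \<phi> \<psi>]
  have "hdiff L (bracket_primitive \<phi> \<psi>) [x, y, z] = 0"
    if L: "x \<in> L" "y \<in> L" "z \<in> L" and out: "x + y + z \<in> L - shifted L (Rstar + Rstar)" for x y z
  proof -
    obtain j where j: "j < n" and xyz: "x + y + z \<in> K2 n a j"
      using out unfolding outside_shifted_2Rstar by blast
    have K: "x + y \<in> K2 n a j" "x \<in> K2 n a j" "y \<in> K2 n a j" "z \<in> K2 n a j" "y + z \<in> K2 n a j"
      by (rule K2_summand[OF j]; use L Lam_add xyz in \<open>simp add: ac_simps\<close>;
          use L Lam_add xyz in \<open>simp add: ac_simps\<close>)+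
    show ?thesis
      using K xyz L out bracket_primitive_on_K2[OF assms j] by (simp add: hdiff_3 add.assoc)
  qed
  then show ?thesis
    using hdiff_cochains_3[OF C Lam_add] hdiff_hdiff_2[OF C Lam_add]
    unfolding rel_cocycles_def rel_cochains_def by (auto simp: tuples_3)
qed

end

lemma sum_fun_apply: "(\<Sum>j\<in>J. h j) xs = (\<Sum>j\<in>J. h j xs)"
  by (induction J rule: infinite_finite_induct) simp_all

context lattice_cone
begin

text \<open>
  The functions \<open>g j\<close>, by which the local primitives change, agree on overlaps. They vanish on every
  face, where \<open>\<phi>\<close> and \<open>\<psi>\<close> are prescribed. An element of two of the sets on no face is \<open>R\<^sup>*\<close> plus an element of
  both faces, and there the linear functions of the two vertices agree.
\<close>

lemma bracket_cohomologous:
  fixes \<phi> :: "lattice list \<Rightarrow> 'k::field_char_0"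
  assumes bb: "T1_choice n a t b" "T1_choice n a s b'"
    and \<phi>: "compatible b \<phi>" "compatible b \<phi>'" and \<psi>: "compatible b' \<psi>" "compatible b' \<psi>'"
  shows "(hdiff L (bracket_primitive \<phi> \<psi>), hdiff L (bracket_primitive \<phi>' \<psi>'))
    \<in> cohomologous 3 L (Rstar + Rstar)"
proof -
  let ?C = "bracket_primitive \<phi> \<psi>" and ?C' = "bracket_primitive \<phi>' \<psi>'"
  define U where "U = L - shifted L (Rstar + Rstar)"
  have U: "r \<in> U \<longleftrightarrow> (\<exists>j<n. r \<in> K2 n a j)" for r
    unfolding U_def by (rule outside_shifted_2Rstar)
  define g where "g j r = local_primitive b b' \<phi>' \<psi>' j r - local_primitive b b' \<phi> \<psi> j r" for j r
  have g: "g j r = pairing (b j) (kvec r) * (\<psi> [r] - \<psi>' [r]) + pairing (b' j) (kvec r) * (\<phi> [r] - \<phi>' [r])"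
    for j r by (simp add: g_def local_primitive_def algebra_simps)
  have agree: "g i r = g j r" if ij: "i < n" "j < n" and r: "r \<in> K2 n a i" "r \<in> K2 n a j" for i j r
  proof (cases "\<exists>l<n. pairing (a l) r = 0")
    case True
    then have "\<phi> [r] = \<phi>' [r]" "\<psi> [r] = \<psi>' [r]"
      using \<phi> \<psi> r ij by (auto simp: compatible_def Kset_iff K2_iff)
    then show ?thesis by (simp add: g)
  next
    case False
    have L: "r \<in> L" using r ij by (simp add: K2_iff)
    then have "pairing (a l) r \<ge> 1" if "l < n" for l
      using False that unfolding Lam_iff by (metis le_less int_one_le_iff_zero_less)
    then have "r - Rstar \<in> Kset n a Rstar i" "r - Rstar \<in> Kset n a Rstar j"
      using r ij by (force simp: Kset_iff K2_iff Lam_iff pairing_simps pairing_a_Rstar)+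
    then have "pairing (b i) (kvec (r - Rstar)) = pairing (b j) (kvec (r - Rstar))"
      "pairing (b' i) (kvec (r - Rstar)) = pairing (b' j) (kvec (r - Rstar))"
      using T1_choice_agree[OF bb(1) ij] T1_choice_agree[OF bb(2) ij] by blast+
    then show ?thesis
      using bb ij by (simp add: g T1_choice_def kvec_simps pairing_simps)
  qed
  define \<gamma> where "\<gamma> r = g (SOME j. j < n \<and> r \<in> K2 n a j) r" for r
  have \<gamma>: "\<gamma> r = g j r" if "j < n" "r \<in> K2 n a j" for j r
    unfolding \<gamma>_def using someI[of "\<lambda>j. j < n \<and> r \<in> K2 n a j" j] that by (intro agree) auto
  define \<Gamma> where "\<Gamma> = fun_cochain U \<gamma>"
  have \<Gamma>: "\<Gamma> \<in> cochains 1 L"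
    unfolding \<Gamma>_def by (rule cochains_1_mono[OF fun_cochain(1)]) (simp add: U_def)
  define D where "D = ?C - (?C' - hdiff L \<Gamma>)"
  have "D \<in> cochains 2 L"
    unfolding D_def by (intro cochains_diff bracket_primitive_cochain hdiff_cochains_2 \<Gamma>)
  moreover have "D [x, y] = 0" if xy: "x \<in> U" "y \<in> U" "x + y \<in> U" for x y
  proof -
    obtain j where j: "j < n" "x + y \<in> K2 n a j" using xy(3) U by blast
    have L: "x \<in> L" "y \<in> L" using xy by (simp_all add: U_def)
    then have K: "x \<in> K2 n a j" "y \<in> K2 n a j"
      using K2_summand[of j x y] K2_summand[of j y x] j by (simp_all add: add.commute)
    have "hdiff L \<Gamma> [x, y] = g j x + g j y - g j (x + y)"
      using L Lam_add K j \<gamma> xy by (simp add: hdiff_2 \<Gamma>_def fun_cochain)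
    then show ?thesis
      using bracket_primitive_on_K2[OF bb \<phi>(1) \<psi>(1) j(1) K j(2)]
        bracket_primitive_on_K2[OF bb \<phi>(2) \<psi>(2) j(1) K j(2)]
      by (simp add: D_def g_def)
  qed
  ultimately have D: "D \<in> rel_cochains 2 L (Rstar + Rstar)"
    unfolding rel_cochains_def U_def[symmetric] mem_Collect_eq Ball_def tuples_2 by blast
  have ddG: "hdiff L (hdiff L \<Gamma>) = 0" by (rule hdiff_hdiff_1[OF \<Gamma> Lam_add])
  have "hdiff L ?C - hdiff L ?C' = hdiff L D"
    by (simp add: D_def hdiff_diff ddG)
  then have "hdiff L ?C - hdiff L ?C' \<in> hdiff L ` rel_cochains (3 - 1) L (Rstar + Rstar)"
    using D by simp
  then show ?thesis
    using bracket_primitive_rel_cocycle[OF bb \<phi>(1) \<psi>(1)] bracket_primitive_rel_cocycle[OF bb \<phi>(2) \<psi>(2)]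
    unfolding cohomologous_def by blast
qed

lemma cup_eq:
  assumes bb: "T1_choice n a t b" "T1_choice n a s b'" and "compatible b \<phi>" "compatible b' \<psi>"
  shows "cup L Rstar Rstar (hdiff L ` {\<phi>. compatible b \<phi>}) (hdiff L ` {\<psi>. compatible b' \<psi>})
    = cohomologous 3 L (Rstar + Rstar) `` {hdiff L (bracket_primitive \<phi> \<psi>)}" (is "_ = ?K")
proof -
  have "cohomologous 3 L (Rstar + Rstar) `` {bracket L Rstar Rstar (hdiff L \<phi>') (hdiff L \<psi>')} = ?K"
    if "compatible b \<phi>'" "compatible b' \<psi>'" for \<phi>' \<psi>'
    unfolding bracket_eq_coboundary[OF that]
    by (rule equiv_class_eq[OF equiv_cohomologous bracket_cohomologous[OF bb that(1) assms(3) that(2) assms(4)]])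
  then show ?thesis unfolding cup_def using assms(3,4) by blast
qed

section \<open>The identification of T2\<close>

text \<open>
  The vector \<open>R\<^sup>*\<close> is interior to the dual cone, so symmetric cocycles on \<open>\<Lambda>\<close> split.
\<close>

lemma cocycle_is_coboundary:
  assumes Z: "Z \<in> cochains 2 L" and zero: "hdiff L Z = 0"
  shows "\<exists>E\<in>cochains 1 L. hdiff L E = Z"
proof -
  have "symmetric_cocycle L (\<lambda>x y. Z [x, y])"
  proof
    fix x y w assume L: "x \<in> L" "y \<in> L" "w \<in> L"
    have "hdiff L Z [x, y, w] = 0" by (simp add: zero)
    then show "Z [x, y] + Z [x + y, w] = Z [y, w] + Z [x, y + w]"
      using L Lam_add by (simp add: hdiff_3 algebra_simps)
  qed (use Z Lam_add Lam_zero in \<open>auto simp: cochains_2\<close>)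
  moreover have "\<exists>c. m + c *s Rstar \<in> L" for m
    using eventually_in_cone[of Rstar m] pairing_a_Rstar by auto
  ultimately obtain E where E: "\<And>x y. x \<in> L \<Longrightarrow> y \<in> L \<Longrightarrow> Z [x, y] = E x + E y - E (x + y)"
    using symmetric_cocycle_on_cone_splits[OF _ _ Rstar_mem] by blast
  have "hdiff L (fun_cochain L E) xs = Z xs" for xs
  proof (cases "xs \<in> tuples 2 L")
    case True
    then show ?thesis using E Lam_add by (auto simp: tuples_2 hdiff_2 fun_cochain)
  next
    case False
    then show ?thesis
      using Z hdiff_cochains_2[OF fun_cochain(1), of L E] by (simp add: cochains_2)
  qed
  then show ?thesis using fun_cochain(1) by blast
qed

lemma pair_restr_eqI:
  assumes "\<And>j r. j < n \<Longrightarrow> r \<in> K2 n a j \<Longrightarrow> r \<in> K2 n a (nxt n j) \<Longrightarrow> h j [r] = h' j [r]"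
    and "\<And>j xs. j < n \<Longrightarrow> length xs \<noteq> 1 \<Longrightarrow> h j xs = h' j xs"
  shows "pair_restr n a h = pair_restr n a h'"
proof -
  have "restr (K2 n a j \<inter> K2 n a (nxt n j)) (h j) xs = restr (K2 n a j \<inter> K2 n a (nxt n j)) (h' j) xs"
    if "j < n" for j xs
    using assms that by (cases "length xs = 1") (auto simp: restr_def tuples_def length_Suc_conv)
  then show ?thesis unfolding pair_restr_def by (intro ext) simp
qed

lemma pair_restr_diff: "pair_restr n a (\<lambda>j. h j - h' j) = pair_restr n a h - pair_restr n a h'"
  by (intro ext) (simp add: pair_restr_def restr_def)

lemma mid_ker_diff: "h \<in> mid_ker n a \<Longrightarrow> h' \<in> mid_ker n a \<Longrightarrow> h - h' \<in> mid_ker n a"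
proof -
  assume h: "h \<in> mid_ker n a" "h' \<in> mid_ker n a"
  have "restr Q (\<Sum>j<n. (h - h') j) = restr Q (\<Sum>j<n. h j) - restr Q (\<Sum>j<n. h' j)" for Q
    by (intro ext) (simp add: restr_def sum_subtractf)
  then show ?thesis using h by (auto simp: mid_ker_def H1_diff)
qed

text \<open>
  Only one-element lists matter, since the restrictions are cochains of degree one.
\<close>

lemma pair_restr_mid_ker:
  assumes H1: "\<And>j. j < n \<Longrightarrow> restr (K2 n a j \<inter> K2 n a (nxt n j)) (h j) \<in> H1 (K2 n a j \<inter> K2 n a (nxt n j))"
    and sum: "\<And>r. (\<And>j. j < n \<Longrightarrow> r \<in> K2 n a j) \<Longrightarrow> (\<Sum>j<n. h j [r]) = 0"
  shows "pair_restr n a h \<in> mid_ker n a"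
proof -
  have "restr (\<Inter>j<n. K2 n a j) (\<Sum>j<n. pair_restr n a h j) xs = 0" for xs
  proof (cases "xs \<in> tuples 1 (\<Inter>j<n. K2 n a j)")
    case True
    then obtain r where r: "xs = [r]" "\<And>j. j < n \<Longrightarrow> r \<in> K2 n a j" unfolding tuples_1 by blast
    have "(\<Sum>j<n. pair_restr n a h j [r]) = (\<Sum>j<n. h j [r])"
      by (rule sum.cong) (use r(2) nxt_less in \<open>auto simp: pair_restr_def restr_single\<close>)
    then show ?thesis using sum[OF r(2)] r by (simp add: restr_def sum_fun_apply)
  next
    case False
    have "pair_restr n a h j xs = 0" if "length xs \<noteq> 1" "j < n" for j
      using H1[OF that(2)] cochain_1_length that unfolding pair_restr_def H1_def by auto
    then show ?thesis using False by (cases "length xs = 1") (auto simp: restr_def sum_fun_apply)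
  qed
  then have "restr (\<Inter>j<n. K2 n a j) (\<Sum>j<n. pair_restr n a h j) = 0" by (intro ext) simp
  then show ?thesis using H1 unfolding mid_ker_def by (auto simp: pair_restr_def)
qed

lemma mid_imI:
  assumes "\<And>j. j < n \<Longrightarrow> g j \<in> H1 (K2 n a j)"
  shows "pair_restr n a (\<lambda>j. g j - g (nxt n j)) \<in> mid_im n a"
  unfolding mid_im_def by (rule CollectI, rule exI[of _ g]) (use assms in simp)

lemma mid_im_subset: "mid_im n a \<subseteq> mid_ker n a"
proof
  fix h assume "h \<in> mid_im n a"
  then obtain g where g: "\<forall>j<n. g j \<in> H1 (K2 n a j)" "h = pair_restr n a (\<lambda>j. g j - g (nxt n j))"
    unfolding mid_im_def by blast
  show "h \<in> mid_ker n a"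
    unfolding g(2)
  proof (rule pair_restr_mid_ker)
    fix j assume j: "j < n"
    let ?Q = "K2 n a j \<inter> K2 n a (nxt n j)"
    have "restr ?Q (g j) - restr ?Q (g (nxt n j)) \<in> H1 ?Q"
      by (rule H1_diff; rule H1_restr[OF g(1)[rule_format]]) (use j nxt_less in auto)
    moreover have "restr ?Q (g j - g (nxt n j)) = restr ?Q (g j) - restr ?Q (g (nxt n j))"
      by (intro ext) (simp add: restr_def)
    ultimately show "restr ?Q (g j - g (nxt n j)) \<in> H1 ?Q" by simp
  next
    fix r
    show "(\<Sum>j<n. (g j - g (nxt n j)) [r]) = 0"
      using sum_nxt[of "\<lambda>j. g j [r]"] by (simp add: sum_subtractf)
  qed
qed

lemma equiv_mid_rel: "equiv (mid_ker n a :: (nat \<Rightarrow> lattice list \<Rightarrow> 'k::field_char_0) set) (mid_rel n a)"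
  unfolding mid_rel_def
proof (rule equiv_diff_subgroup)
  have "pair_restr n a (\<lambda>j. 0 - 0) = (0 :: nat \<Rightarrow> lattice list \<Rightarrow> 'k)"
    by (intro ext) (simp add: pair_restr_def restr_def)
  then show "0 \<in> (mid_im n a :: (nat \<Rightarrow> lattice list \<Rightarrow> 'k) set)"
    using mid_imI[of "\<lambda>_. 0 :: lattice list \<Rightarrow> 'k", OF H1_zero] by simp
next
  fix h h' :: "nat \<Rightarrow> lattice list \<Rightarrow> 'k" assume "h \<in> mid_im n a" "h' \<in> mid_im n a"
  then obtain g g' where g: "\<forall>j<n. g j \<in> H1 (K2 n a j)" "h = pair_restr n a (\<lambda>j. g j - g (nxt n j))"
    and g': "\<forall>j<n. g' j \<in> H1 (K2 n a j)" "h' = pair_restr n a (\<lambda>j. g' j - g' (nxt n j))"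
    unfolding mid_im_def by blast
  have "h - h' = pair_restr n a (\<lambda>j. (g j - g' j) - (g (nxt n j) - g' (nxt n j)))"
    unfolding g(2) g'(2) pair_restr_diff[symmetric] by (simp add: algebra_simps)
  moreover have "g j - g' j \<in> H1 (K2 n a j)" if "j < n" for j
    using g(1) g'(1) H1_diff that by blast
  ultimately show "h - h' \<in> mid_im n a" using mid_imI[of "\<lambda>j. g j - g' j"] by simp
qed

lemma im_deltaI:
  assumes "\<And>j. j < n \<Longrightarrow> q j = b j - b (nxt n j) + c j *s (edge_delta n a j *s kvec (edge_vec n a j))"
    and "\<And>j. j \<ge> n \<Longrightarrow> q j = 0"
  shows "q \<in> im_delta n a"
  unfolding im_delta_def using assms by blast

lemma im_delta_diff:
  assumes "q \<in> im_delta n a" "q' \<in> im_delta n a"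
  shows "q - q' \<in> im_delta n a"
proof -
  obtain b c b' c' where
    "\<forall>j<n. q j = b j - b (nxt n j) + c j *s (edge_delta n a j *s kvec (edge_vec n a j))"
    "\<forall>j<n. q' j = b' j - b' (nxt n j) + c' j *s (edge_delta n a j *s kvec (edge_vec n a j))"
    using assms unfolding im_delta_def by blast
  then have "(q - q') j = (b j - b' j) - (b (nxt n j) - b' (nxt n j))
      + (c j - c' j) *s (edge_delta n a j *s kvec (edge_vec n a j))" if "j < n" for j
    using that by (simp add: left_diff_distrib vec.scale_left_diff_distrib)
  then show ?thesis
    by (rule im_deltaI) (use assms in \<open>auto simp: im_delta_def\<close>)
qed

lemma equiv_eta_rel: "equiv (ker_eta n a :: (nat \<Rightarrow> 'k::field_char_0^3) set) (eta_rel n a)"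
  unfolding eta_rel_def
proof (rule equiv_diff_subgroup[OF _ im_delta_diff])
  show "(0 :: nat \<Rightarrow> 'k^3) \<in> im_delta n a"
    by (rule im_deltaI[of _ "\<lambda>_. 0" "\<lambda>_. 0"]) simp_all
qed

text \<open>
  A linear condition on a span may be checked on the generators.
\<close>

lemma ker_eta_iff:
  "q \<in> ker_eta n a \<longleftrightarrow> (\<forall>j\<ge>n. q j = 0) \<and>
     (\<forall>r. (\<forall>j<n. r \<in> K2 n a j) \<longrightarrow> (\<Sum>j<n. pairing (q j) (kvec r)) = 0)"
proof -
  let ?S = "\<Inter>j<n. K2 n a j" and ?Q = "\<Sum>j<n. q j"
  have "(\<forall>m\<in>vec.span (kvec ` ?S). pairing ?Q m = 0) \<longleftrightarrow> (\<forall>r\<in>?S. pairing ?Q (kvec r) = 0)"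
  proof
    assume r: "\<forall>r\<in>?S. pairing ?Q (kvec r) = 0"
    have "vec.span (kvec ` ?S) \<subseteq> {m. pairing ?Q m = 0}"
    proof (rule vec.span_minimal)
      show "vec.subspace {m. pairing ?Q m = 0}"
        by (auto simp: vec.subspace_def pairing_simps)
    qed (use r in auto)
    then show "\<forall>m\<in>vec.span (kvec ` ?S). pairing ?Q m = 0" by blast
  qed (auto intro: vec.span_base)
  then show ?thesis unfolding ker_eta_def by (auto simp: pairing_sum_left)
qed

lemma lin_fun_mid_ker:
  assumes "q \<in> ker_eta n a"
  shows "pair_restr n a (\<lambda>j. lin_fun (q j)) \<in> mid_ker n a"
  using assms by (intro pair_restr_mid_ker lin_fun_restr_H1) (auto simp: ker_eta_iff lin_fun)

text \<open>
  This is the injectivity of the comparison between \<open>ker \<eta> / im \<delta>\<close> and the middle cohomology: functions on the sets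
  \<open>K2\<close> that realise the restriction of \<open>q\<close> as a boundary are linear, and what they leave over vanishes on the overlaps.
\<close>

lemma lin_fun_mid_im_iff:
  fixes q :: "nat \<Rightarrow> 'k::field_char_0^3"
  assumes "\<forall>j\<ge>n. q j = 0"
  shows "pair_restr n a (\<lambda>j. lin_fun (q j)) \<in> mid_im n a \<longleftrightarrow> q \<in> im_delta n a"
proof
  assume "pair_restr n a (\<lambda>j. lin_fun (q j)) \<in> mid_im n a"
  then obtain g where g: "\<And>j. j < n \<Longrightarrow> g j \<in> H1 (K2 n a j)"
    and eq: "pair_restr n a (\<lambda>j. lin_fun (q j)) = pair_restr n a (\<lambda>j. g j - g (nxt n j))"
    unfolding mid_im_def by auto
  have "\<exists>b. \<forall>r\<in>K2 n a j. g j [r] = pairing b (kvec r)" if "j < n" for j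
    by (rule additive_on_K2_linear[OF that]) (use g[OF that] in \<open>auto simp: H1_iff\<close>)
  then obtain b where b: "\<And>j r. j < n \<Longrightarrow> r \<in> K2 n a j \<Longrightarrow> g j [r] = pairing (b j) (kvec r)"
    by metis
  have "\<exists>c. q j - (b j - b (nxt n j)) = c *s (edge_delta n a j *s kvec (edge_vec n a j))" if j: "j < n" for j
  proof (rule annihilator_of_edge[OF j])
    fix r assume r: "r \<in> K2 n a j" "r \<in> K2 n a (nxt n j)"
    have "pairing (q j) (kvec r) = g j [r] - g (nxt n j) [r]"
      using fun_cong[OF fun_cong[OF eq, of j], of "[r]"] j r
      by (simp add: pair_restr_def restr_single lin_fun)
    then show "pairing (q j - (b j - b (nxt n j))) (kvec r) = 0"
      using b j nxt_less r by (simp add: pairing_simps)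
  qed
  then obtain c where "\<And>j. j < n \<Longrightarrow> q j - (b j - b (nxt n j)) = c j *s (edge_delta n a j *s kvec (edge_vec n a j))"
    by metis
  then have "\<forall>j<n. q j = b j - b (nxt n j) + c j *s (edge_delta n a j *s kvec (edge_vec n a j))"
    by (simp add: algebra_simps)
  then show "q \<in> im_delta n a" using assms unfolding im_delta_def by blast
next
  assume "q \<in> im_delta n a"
  then obtain b c where q: "\<And>j. j < n \<Longrightarrow> q j = b j - b (nxt n j) + c j *s (edge_delta n a j *s kvec (edge_vec n a j))"
    unfolding im_delta_def by blast
  define g where "g j = restr (K2 n a j) (lin_fun (b j))" for j
  have g: "g j \<in> H1 (K2 n a j)" for j unfolding g_def by (rule lin_fun_restr_H1)
  have "pair_restr n a (\<lambda>j. lin_fun (q j)) = pair_restr n a (\<lambda>j. g j - g (nxt n j))"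
  proof (rule pair_restr_eqI)
    fix j r assume j: "j < n" and r: "r \<in> K2 n a j" "r \<in> K2 n a (nxt n j)"
    have "pairing (q j) (kvec r) = pairing (b j) (kvec r) - pairing (b (nxt n j)) (kvec r)
        + c j * (edge_delta n a j * pairing (kvec (edge_vec n a j)) (kvec r))"
      unfolding q[OF j] pairing_simps ..
    then show "lin_fun (q j) [r] = (g j - g (nxt n j)) [r]"
      unfolding edge_delta_vanishes[OF j r] using r by (simp add: lin_fun g_def restr_single)
  next
    fix j and xs :: "lattice list" assume "length xs \<noteq> 1"
    then show "lin_fun (q j) xs = (g j - g (nxt n j)) xs"
      by (simp add: lin_fun_def g_def restr_def)
  qed
  then show "pair_restr n a (\<lambda>j. lin_fun (q j)) \<in> mid_im n a"
    using mid_imI[of g, OF g] by simp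
qed

text \<open>
  The sum of \<open>s\<^sub>j t\<^sub>j d\<^sub>j\<close> telescopes, as each term is a difference of local primitives.
\<close>

lemma edge_product_ker_eta:
  assumes ts: "t \<in> Vsp n a" and bb: "T1_choice n a t b" "T1_choice n a s b'"
    and "compatible b \<phi>" "compatible b' \<psi>"
  shows "(\<lambda>j. (s j * t j) *s kvec (edge_vec n a j)) \<in> ker_eta n a"
  unfolding ker_eta_iff
proof (intro conjI allI impI)
  fix r assume r: "\<forall>j<n. r \<in> K2 n a j"
  let ?G = "\<lambda>j. local_primitive b b' \<phi> \<psi> j r"
  have "(\<Sum>j<n. pairing ((s j * t j) *s kvec (edge_vec n a j)) (kvec r)) = (\<Sum>j<n. ?G (nxt n j) - ?G j)"
    using local_primitive_edge[OF assms(2-5)] r nxt_less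
    by (intro sum.cong) (auto simp: pairing_simps)
  then show "(\<Sum>j<n. pairing ((s j * t j) *s kvec (edge_vec n a j)) (kvec r)) = 0"
    using sum_nxt[of ?G] by (simp add: sum_subtractf)
qed (use ts in \<open>simp add: Vsp_def\<close>)

lemma local_primitive_coboundary:
  assumes "T1_choice n a t b" "T1_choice n a s b'" "compatible b \<phi>" "compatible b' \<psi>" and j: "j < n"
  shows "hdiff (K2 n a j) (fun_cochain (K2 n a j) (local_primitive b b' \<phi> \<psi> j))
    = restr (K2 n a j) (bracket_primitive \<phi> \<psi>)"
proof
  fix xs
  let ?Q = "K2 n a j" and ?G = "fun_cochain (K2 n a j) (local_primitive b b' \<phi> \<psi> j)"
  show "hdiff ?Q ?G xs = restr ?Q (bracket_primitive \<phi> \<psi>) xs"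
  proof (cases "xs \<in> tuples 2 ?Q")
    case True
    then obtain x y where xs: "xs = [x, y]" "x \<in> ?Q" "y \<in> ?Q" "x + y \<in> ?Q" by (auto simp: tuples_2)
    then have "restr ?Q (bracket_primitive \<phi> \<psi>) xs = bracket_primitive \<phi> \<psi> [x, y]"
      by (simp add: restr_def tuples_def)
    then show ?thesis
      using bracket_primitive_on_K2[OF assms xs(2-4)] xs by (simp add: hdiff_2 fun_cochain)
  next
    case False
    then have "hdiff ?Q ?G xs = 0"
      using hdiff_cochains_2[OF fun_cochain(1), of ?Q "local_primitive b b' \<phi> \<psi> j"] by (simp add: cochains_2)
    moreover have "restr ?Q (bracket_primitive \<phi> \<psi>) xs = 0"
      using False by (auto simp: restr_def bracket_primitive_def tuples_def)
    ultimately show ?thesis by simp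
  qed
qed

text \<open>
  A primitive \<open>C'\<close> of a cohomologous cocycle and the primitive \<open>C\<close> of the bracket differ by \<open>dE\<close> up to a cochain
  that vanishes on the sets \<open>K2\<close>. Hence \<open>G\<^sub>j\<close> and the local primitive of \<open>C\<close> differ on \<open>K2\<close> by \<open>E\<close> and an additive
  function. In the differences of neighbours \<open>E\<close> cancels, and the additive functions only contribute a boundary.
\<close>

lemma T2_mid_eq:
  fixes t s :: "nat \<Rightarrow> 'k::field_char_0"
  assumes ts: "t \<in> Vsp n a" and bb: "T1_choice n a t b" "T1_choice n a s b'"
    and \<phi>\<psi>: "compatible b \<phi>" "compatible b' \<psi>"
  shows "T2_mid n a (cohomologous 3 L (Rstar + Rstar) `` {hdiff L (bracket_primitive \<phi> \<psi>)})
    = mid_rel n a `` {pair_restr n a (\<lambda>j. lin_fun ((s j * t j) *s kvec (edge_vec n a j)))}"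
    (is "T2_mid n a ?A = mid_rel n a `` {?h}")
proof -
  let ?C = "bracket_primitive \<phi> \<psi>"
  define G0 where "G0 j = fun_cochain (K2 n a j) (local_primitive b b' \<phi> \<psi> j)" for j
  have G0: "G0 j \<in> cochains 1 (K2 n a j)" for j unfolding G0_def by (rule fun_cochain)
  have dG0: "hdiff (K2 n a j) (G0 j) = restr (K2 n a j) ?C" if "j < n" for j
    unfolding G0_def by (rule local_primitive_coboundary[OF bb \<phi>\<psi> that])
  have h: "pair_restr n a (\<lambda>j. G0 (nxt n j) - G0 j) = ?h"
  proof (rule pair_restr_eqI)
    fix j r assume j: "j < n" and r: "r \<in> K2 n a j" "r \<in> K2 n a (nxt n j)"
    show "(G0 (nxt n j) - G0 j) [r] = lin_fun ((s j * t j) *s kvec (edge_vec n a j)) [r]"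
      using local_primitive_edge[OF bb \<phi>\<psi> j r] r by (simp add: G0_def fun_cochain lin_fun pairing_simps)
  next
    fix j and xs :: "lattice list" assume "length xs \<noteq> 1"
    then show "(G0 (nxt n j) - G0 j) xs = lin_fun ((s j * t j) *s kvec (edge_vec n a j)) xs"
      using cochain_1_length[OF G0] by (simp add: lin_fun)
  qed
  have h_ker: "?h \<in> mid_ker n a"
    by (rule lin_fun_mid_ker[OF edge_product_ker_eta[OF ts bb \<phi>\<psi>]])
  have "hdiff L ?C \<in> ?A"
    using equiv_class_self[OF equiv_cohomologous] bracket_primitive_rel_cocycle[OF bb \<phi>\<psi>] by blast
  moreover have "T2_choice n a (hdiff L ?C) G0"
    unfolding T2_choice_def using bracket_primitive_cochain G0 dG0 by blast
  moreover have "mid_rel n a `` {pair_restr n a (\<lambda>j. G (nxt n j) - G j)} = mid_rel n a `` {?h}"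
    if c: "c \<in> ?A" and G: "T2_choice n a c G" for c G
  proof -
    obtain D where D: "D \<in> rel_cochains 2 L (Rstar + Rstar)" "hdiff L ?C - c = hdiff L D"
      using c unfolding cohomologous_def by auto
    obtain C' where C': "C' \<in> cochains 2 L" "hdiff L C' = c"
      and dG: "\<And>j. j < n \<Longrightarrow> G j \<in> cochains 1 (K2 n a j)"
        "\<And>j. j < n \<Longrightarrow> hdiff (K2 n a j) (G j) = restr (K2 n a j) C'"
      using G unfolding T2_choice_def by blast
    have "C' - (?C - D) \<in> cochains 2 L"
      using C'(1) D(1) bracket_primitive_cochain cochains_diff unfolding rel_cochains_def by blast
    moreover have "hdiff L (C' - (?C - D)) = 0"
      unfolding hdiff_diff C'(2) D(2)[symmetric] by simp
    ultimately obtain E where E: "E \<in> cochains 1 L" "hdiff L E = C' - (?C - D)"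
      using cocycle_is_coboundary by blast
    define H where "H j = G0 j - (G j - restr (K2 n a j) E)" for j
    have H: "H j \<in> H1 (K2 n a j)" if j: "j < n" for j
    proof -
      let ?Q = "K2 n a j"
      have QL: "?Q \<subseteq> L" using j by (auto simp: K2_iff)
      have "H j \<in> cochains 1 ?Q"
        unfolding H_def by (intro cochains_diff G0 dG(1)[OF j] restr_cochain_1[OF E(1)])
      moreover have "H j [x + y] = H j [x] + H j [y]" if xy: "x \<in> ?Q" "y \<in> ?Q" "x + y \<in> ?Q" for x y
      proof -
        have "x \<in> L - shifted L (Rstar + Rstar)" "y \<in> L - shifted L (Rstar + Rstar)"
          "x + y \<in> L - shifted L (Rstar + Rstar)"
          using xy j outside_shifted_2Rstar by blast+
        then have "D [x, y] = 0" using D(1) unfolding rel_cochains_def by (simp add: tuples_2)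
        moreover have "E [x] + E [y] - E [x + y] = C' [x, y] - (?C [x, y] - D [x, y])"
          using fun_cong[OF E(2), of "[x, y]"] xy QL by (auto simp: hdiff_2 subset_iff)
        moreover have "G j [x] + G j [y] - G j [x + y] = C' [x, y]"
          using fun_cong[OF dG(2)[OF j], of "[x, y]"] xy by (simp add: hdiff_2 restr_def tuples_def)
        moreover have "G0 j [x] + G0 j [y] - G0 j [x + y] = ?C [x, y]"
          using fun_cong[OF dG0[OF j], of "[x, y]"] xy by (simp add: hdiff_2 restr_def tuples_def)
        ultimately have "H j [x] + H j [y] - H j [x + y] = 0"
          using xy by (simp add: H_def restr_single algebra_simps)
        then show ?thesis by simp
      qed
      ultimately show ?thesis unfolding H1_iff by blast
    qed
    have "pair_restr n a (\<lambda>j. H j - H (nxt n j))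
        = pair_restr n a (\<lambda>j. (G (nxt n j) - G j) - (G0 (nxt n j) - G0 j))"
    proof (rule pair_restr_eqI)
      fix j r assume "j < n" "r \<in> K2 n a j" "r \<in> K2 n a (nxt n j)"
      then show "(H j - H (nxt n j)) [r] = ((G (nxt n j) - G j) - (G0 (nxt n j) - G0 j)) [r]"
        by (simp add: H_def restr_single)
    next
      fix j and xs :: "lattice list" assume "j < n" "length xs \<noteq> 1"
      then show "(H j - H (nxt n j)) xs = ((G (nxt n j) - G j) - (G0 (nxt n j) - G0 j)) xs"
        using cochain_1_length[OF E(1)] by (simp add: H_def restr_def)
    qed
    then have eq: "pair_restr n a (\<lambda>j. G (nxt n j) - G j) - ?h = pair_restr n a (\<lambda>j. H j - H (nxt n j))"
      unfolding h[symmetric] pair_restr_diff by simp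
    have im: "pair_restr n a (\<lambda>j. G (nxt n j) - G j) - ?h \<in> mid_im n a"
      unfolding eq by (rule mid_imI[OF H])
    have "0 - ?h \<in> mid_ker n a"
      by (rule mid_ker_diff[OF _ h_ker]) (use mid_ker_diff[OF h_ker h_ker] in simp)
    then have "pair_restr n a (\<lambda>j. G (nxt n j) - G j) \<in> mid_ker n a"
      using mid_ker_diff[OF subsetD[OF mid_im_subset im], of "0 - ?h"] by simp
    then have "(pair_restr n a (\<lambda>j. G (nxt n j) - G j), ?h) \<in> mid_rel n a"
      using h_ker im unfolding mid_rel_def by blast
    then show ?thesis by (rule equiv_class_eq[OF equiv_mid_rel])
  qed
  ultimately show ?thesis unfolding T2_mid_def by blast
qed

lemma T2_ident_eq:
  assumes ts: "t \<in> Vsp n a" and bb: "T1_choice n a t b" "T1_choice n a s b'"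
    and \<phi>\<psi>: "compatible b \<phi>" "compatible b' \<psi>"
  shows "T2_ident n a (cohomologous 3 L (Rstar + Rstar) `` {hdiff L (bracket_primitive \<phi> \<psi>)})
    = eta_rel n a `` {\<lambda>j. (s j * t j) *s kvec (edge_vec n a j)}"
proof -
  let ?q = "\<lambda>j. (s j * t j) *s kvec (edge_vec n a j)"
  have q: "?q \<in> ker_eta n a" by (rule edge_product_ker_eta[OF assms])
  have "pair_restr n a (\<lambda>j. lin_fun (q j)) \<in> mid_rel n a `` {pair_restr n a (\<lambda>j. lin_fun (?q j))}
      \<longleftrightarrow> ?q - q \<in> im_delta n a" if q': "q \<in> ker_eta n a" for q
  proof -
    have "lin_fun (?q j) - lin_fun (q j) = lin_fun ((?q - q) j)" for j
      by (intro ext) (simp add: lin_fun_def pairing_simps)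
    then have "pair_restr n a (\<lambda>j. lin_fun (?q j)) - pair_restr n a (\<lambda>j. lin_fun (q j))
        = pair_restr n a (\<lambda>j. lin_fun ((?q - q) j))"
      unfolding pair_restr_diff[symmetric] by simp
    moreover have "\<forall>j\<ge>n. (?q - q) j = 0" using q q' unfolding ker_eta_iff by simp
    ultimately show ?thesis
      using lin_fun_mid_im_iff[of "?q - q"] lin_fun_mid_ker[OF q] lin_fun_mid_ker[OF q']
      unfolding mid_rel_def by simp
  qed
  then show ?thesis
    unfolding T2_ident_def T2_mid_eq[OF assms] eta_rel_def using q by blast
qed

text \<open>
  If \<open>t\<close> and \<open>s\<close> change by the constants \<open>c\<close> and \<open>d\<close>, then \<open>s\<^sub>j t\<^sub>j d\<^sub>j\<close> changes by
  \<open>(c s\<^sub>j + d t\<^sub>j + c d) d\<^sub>j\<close>, which is the step from \<open>j\<close> to the next vertex of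
  \<open>c b'\<^sub>j + d b\<^sub>j + c d a\<^sub>j\<close>.
\<close>

lemma edge_product_eq:
  fixes t s :: "nat \<Rightarrow> 'k::field_char_0"
  assumes \<tau>: "\<tau> \<in> Vsp n a // mod_ones n a" "t \<in> \<tau>" and \<sigma>: "\<sigma> \<in> Vsp n a // mod_ones n a" "s \<in> \<sigma>"
  shows "edge_product n a \<tau> \<sigma> = eta_rel n a `` {\<lambda>j. (s j * t j) *s kvec (edge_vec n a j)}"
proof -
  let ?q = "\<lambda>t s j. (s j * t j) *s (kvec (edge_vec n a j) :: 'k^3)"
  have ker: "?q t' s' \<in> ker_eta n a" if ts: "t' \<in> Vsp n a" "s' \<in> Vsp n a" for t' s' :: "nat \<Rightarrow> 'k"
  proof -
    obtain b where b: "T1_choice n a t' b" using T1_choice_exists[OF ts(1)] .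
    obtain b' where b': "T1_choice n a s' b'" using T1_choice_exists[OF ts(2)] .
    obtain \<phi> where \<phi>: "T1_glued n a b \<phi>" using T1_glued_exists[OF b] .
    obtain \<psi> where \<psi>: "T1_glued n a b' \<psi>" using T1_glued_exists[OF b'] .
    show ?thesis
      by (rule edge_product_ker_eta[OF ts(1) b b' T1_glued_compatible[OF \<phi>] T1_glued_compatible[OF \<psi>]])
  qed
  have "eta_rel n a `` {?q t' s'} = eta_rel n a `` {?q t s}" if ts: "t' \<in> \<tau>" "s' \<in> \<sigma>" for t' s'
  proof -
    have rel: "(t', t) \<in> mod_ones n a" "(s', s) \<in> mod_ones n a"
      using quotient_eq_iff[OF equiv_mod_ones \<tau>(1) \<tau>(1) ts(1) \<tau>(2)]
        quotient_eq_iff[OF equiv_mod_ones \<sigma>(1) \<sigma>(1) ts(2) \<sigma>(2)] by simp_all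
    then obtain c d where V: "t' \<in> Vsp n a" "t \<in> Vsp n a" "s' \<in> Vsp n a" "s \<in> Vsp n a"
      and cd: "\<And>j. j < n \<Longrightarrow> t' j - t j = c" "\<And>j. j < n \<Longrightarrow> s' j - s j = d"
      unfolding mod_ones_def by auto
    obtain b where b: "T1_choice n a t b" using T1_choice_exists[OF V(2)] .
    obtain b' where b': "T1_choice n a s b'" using T1_choice_exists[OF V(4)] .
    define \<beta> where "\<beta> j = - (c *s b' j + d *s b j + (c * d) *s kvec (a j))" for j
    have "?q t' s' - ?q t s \<in> im_delta n a"
    proof (rule im_deltaI)
      fix j assume j: "j < n"
      have e: "t' j = t j + c" "s' j = s j + d" using cd[OF j] by (simp_all add: algebra_simps)
      have step: "b (nxt n j) = b j + t j *s kvec (edge_vec n a j)"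
        "b' (nxt n j) = b' j + s j *s kvec (edge_vec n a j)"
        "kvec (a (nxt n j)) = kvec (a j) + (kvec (edge_vec n a j) :: 'k^3)"
        using b b' j by (auto simp: T1_choice_def edge_vec_def kvec_simps algebra_simps)
      show "(?q t' s' - ?q t s) j
          = \<beta> j - \<beta> (nxt n j) + 0 *s (edge_delta n a j *s kvec (edge_vec n a j))"
        unfolding \<beta>_def step by (simp add: e vec_eq_iff algebra_simps)
    next
      fix j assume "j \<ge> n"
      then show "(?q t' s' - ?q t s) j = 0" using V by (simp add: Vsp_def)
    qed
    then have "(?q t' s', ?q t s) \<in> eta_rel n a"
      using ker V unfolding eta_rel_def by blast
    then show ?thesis by (rule equiv_class_eq[OF equiv_eta_rel])
  qed
  then show ?thesis unfolding edge_product_def using \<tau>(2) \<sigma>(2) by blast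
qed

end

theorem theorem4p4:
  fixes n :: nat and a :: "nat \<Rightarrow> lattice"
    and \<tau> \<sigma> :: "(nat \<Rightarrow> 'k::field_char_0) set"
  assumes "lattice_polygon n a"
    and "\<tau> \<in> Vsp n a // mod_ones n a" and "\<sigma> \<in> Vsp n a // mod_ones n a"
  shows "T1_ident n a \<tau> \<in> T_mod 1 (Lam n a) Rstar
    \<and> T1_ident n a \<sigma> \<in> T_mod 1 (Lam n a) Rstar
    \<and> cup (Lam n a) Rstar Rstar (T1_ident n a \<tau>) (T1_ident n a \<sigma>)
        \<in> T_mod 2 (Lam n a) (Rstar + Rstar)
    \<and> edge_product n a \<tau> \<sigma> \<in> ker_eta n a // eta_rel n a
    \<and> T2_ident n a (cup (Lam n a) Rstar Rstar (T1_ident n a \<tau>) (T1_ident n a \<sigma>))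
        = edge_product n a \<tau> \<sigma>"
proof -
  interpret lattice_cone n a by unfold_locales (rule assms(1))
  obtain t where t: "t \<in> \<tau>" "t \<in> Vsp n a"
    using assms(2) equiv_mod_ones by (metis in_quotient_imp_non_empty in_quotient_imp_subset ex_in_conv subsetD)
  obtain s where s: "s \<in> \<sigma>" "s \<in> Vsp n a"
    using assms(3) equiv_mod_ones by (metis in_quotient_imp_non_empty in_quotient_imp_subset ex_in_conv subsetD)
  obtain b where b: "T1_choice n a t b" using T1_choice_exists[OF t(2)] .
  obtain b' where b': "T1_choice n a s b'" using T1_choice_exists[OF s(2)] .
  obtain \<phi> where "T1_glued n a b \<phi>" using T1_glued_exists[OF b] .
  then have \<phi>: "compatible b \<phi>" by (rule T1_glued_compatible)
  obtain \<psi> where "T1_glued n a b' \<psi>" using T1_glued_exists[OF b'] .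
  then have \<psi>: "compatible b' \<psi>" by (rule T1_glued_compatible)
  note tau = T1_ident_eq[OF assms(2) t(1) b] and sigma = T1_ident_eq[OF assms(3) s(1) b']
  have cup: "cup L Rstar Rstar (T1_ident n a \<tau>) (T1_ident n a \<sigma>)
      = cohomologous 3 L (Rstar + Rstar) `` {hdiff L (bracket_primitive \<phi> \<psi>)}"
    unfolding tau sigma by (rule cup_eq[OF b b' \<phi> \<psi>])
  have "cup L Rstar Rstar (T1_ident n a \<tau>) (T1_ident n a \<sigma>) \<in> T_mod 2 L (Rstar + Rstar)"
    unfolding cup T_mod_def using quotientI[OF bracket_primitive_rel_cocycle[OF b b' \<phi> \<psi>]]
    by (simp add: numeral_3_eq_3)
  moreover have "edge_product n a \<tau> \<sigma> \<in> ker_eta n a // eta_rel n a"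
    unfolding edge_product_eq[OF assms(2) t(1) assms(3) s(1)]
    by (rule quotientI[OF edge_product_ker_eta[OF t(2) b b' \<phi> \<psi>]])
  moreover have "T2_ident n a (cup L Rstar Rstar (T1_ident n a \<tau>) (T1_ident n a \<sigma>)) = edge_product n a \<tau> \<sigma>"
    unfolding cup T2_ident_eq[OF t(2) b b' \<phi> \<psi>] edge_product_eq[OF assms(2) t(1) assms(3) s(1)] ..
  ultimately show ?thesis
    using T1_ident_in_T_mod assms(2,3) by blast
qed

end
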